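(* For all $-\infty<a<b<\infty$ and every small enough $\delta>0$ there is a finite constant $C_\delta$, depending only on $a$, $b$ and $\delta$, such that the following holds. Let $S$ be any subset of $\{-1,+1\}^N$ with $|S|\ge\exp(N\delta)$, and let $g$ be a standard gaussian random vector in $\mathbb{R}^N$. Then $$\mathbb{P}\bigg(\frac1{|S|}\bigg|\bigg\{\sigma\in S:\frac{(g,\sigma)}{N^{1/2}}\in[a,b]\bigg\}\bigg|<\frac1{\exp(w)}\bigg)\le\exp\bigg(-\frac{w}{C_\delta}\bigg)$$ for all $w$ with $C_\delta\le w\le N^{1/2}/C_\delta$.
   Context: $(\cdot,\cdot)$ denotes the Euclidean scalar product on $\mathbb{R}^N$. The set $S$ is deterministic; all randomness is in $g$. *)

theory Defs
  imports "HOL-Probability.Probability"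
begin

text \<open>
  Vectors in \<open>\<real>\<^sup>N\<close> are functions \<open>nat \<Rightarrow> real\<close> that are extensional on \<open>{..<N}\<close>: the dimension has to
  be an ordinary variable, because the constant in the theorem must not depend on it.
\<close>

definition scalar_prod :: "nat \<Rightarrow> (nat \<Rightarrow> real) \<Rightarrow> (nat \<Rightarrow> real) \<Rightarrow> real" where
  "scalar_prod N x y = (\<Sum>i<N. x i * y i)"

definition hypercube :: "nat \<Rightarrow> (nat \<Rightarrow> real) set" where
  "hypercube N = {..<N} \<rightarrow>\<^sub>E {-1, 1}"

definition std_gaussian :: "nat \<Rightarrow> (nat \<Rightarrow> real) measure" where
  "std_gaussian N = (\<Pi>\<^sub>M i\<in>{..<N}. density lborel (\<lambda>x. ennreal (std_normal_density x)))"

text \<open>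
  A probability involving a standard gaussian random vector depends only on its law, so it is taken
  with respect to the law itself. The next lemma says that this is the law of every
  vector of independent standard normal coordinates, on whatever probability space.
\<close>

lemma (in prob_space) distr_std_gaussian:
  fixes g :: "'a \<Rightarrow> nat \<Rightarrow> real"
  assumes "N \<ge> 1"
    and indep: "indep_vars (\<lambda>_. borel) (\<lambda>i \<omega>. g \<omega> i) {..<N}"
    and normal: "\<And>i. i < N \<Longrightarrow> distributed M lborel (\<lambda>\<omega>. g \<omega> i) std_normal_density"
  shows "distr M (\<Pi>\<^sub>M i\<in>{..<N}. borel) (\<lambda>\<omega>. \<lambda>i\<in>{..<N}. g \<omega> i) = std_gaussian N"
proof -
  have rv: "random_variable borel (\<lambda>\<omega>. g \<omega> i)" if "i < N" for i
    using distributed_measurable[OF normal[OF that]] by simp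
  have law: "distr M borel (\<lambda>\<omega>. g \<omega> i) = density lborel (\<lambda>x. ennreal (std_normal_density x))"
    if "i < N" for i
    using distributed_distr_eq_density[OF normal[OF that]]
    by (metis distr_cong sets_lborel)
  have "distr M (\<Pi>\<^sub>M i\<in>{..<N}. borel) (\<lambda>\<omega>. \<lambda>i\<in>{..<N}. g \<omega> i)
      = (\<Pi>\<^sub>M i\<in>{..<N}. distr M borel (\<lambda>\<omega>. g \<omega> i))"
    using indep_vars_iff_distr_eq_PiM'[of "{..<N}" "\<lambda>i \<omega>. g \<omega> i" "\<lambda>_. borel"] indep rv \<open>N \<ge> 1\<close>
    by (auto simp: lessThan_empty_iff)
  also have "\<dots> = std_gaussian N"
    unfolding std_gaussian_def by (rule PiM_cong) (auto simp: law)
  finally show ?thesis .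
qed

end

theory Submission
  imports Defs
begin

text \<open>
  Reveal the Gaussian vector in \<open>n\<close> independent steps, where \<open>n\<close> is proportional to \<open>w\<close>, and keep at each
  step a fixed proportion \<open>c\<close> of the surviving points of \<open>S\<close>; at the end a proportion of about \<open>c ^ n\<close>,
  hence at least \<open>exp (- w)\<close>, remains, and the points that remain have to lie in the strip.
  Let \<open>V\<close> be the largest distance of a surviving point from the middle of the strip and \<open>T\<close> the
  variance still to be revealed. The potential \<open>exp (V\<^sup>2 / T) * T ^ k\<close> decreases in expectation by a constant
  factor in every step: when \<open>V\<^sup>2 / T\<close> is bounded, because \<open>T\<close> shrinks by a constant factor; when
  it is large, because a step of variance of order \<open>T\<^sup>2 / V\<^sup>2\<close> lets the selection create a drift towards the
  strip. The drift exists because \<open>S\<close> is so large that most pairs of points have overlap at most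
  \<open>1 - \<eta>\<close> in absolute value, so that the smaller of their two displacements has negative mean. A small final
  potential forces both \<open>V\<close> and \<open>T\<close> to be small, so the failure probability is exponentially small in \<open>n\<close>.
  Coordinates are rescaled by \<open>sqrt T\<close> throughout: \<open>y = V / sqrt T\<close> is the position, \<open>r\<close> is the half-width of
  the strip over \<open>sqrt T\<close>, and \<open>Q\<close> stands for \<open>exp (y\<^sup>2)\<close>.
\<close>

section \<open>Gaussian vectors\<close>

abbreviation std_normal :: "real measure" where
  "std_normal \<equiv> density lborel (\<lambda>x. ennreal (std_normal_density x))"

lemma prob_space_std_normal: "prob_space std_normal"
  using prob_space_normal_density[of 1 0] by simp

lemma prob_space_std_gaussian: "prob_space (std_gaussian N)"
  unfolding std_gaussian_def by (intro prob_space_PiM prob_space_std_normal)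

lemma sets_std_gaussian [measurable_cong]:
  "sets (std_gaussian N) = sets (\<Pi>\<^sub>M i\<in>{..<N}. borel)"
  unfolding std_gaussian_def by (intro sets_PiM_cong) auto

lemma space_std_gaussian: "space (std_gaussian N) = {..<N} \<rightarrow>\<^sub>E UNIV"
  unfolding std_gaussian_def by (simp add: space_PiM)

lemma scalar_prod_measurable [measurable]:
  "(\<lambda>g. scalar_prod N g v) \<in> borel_measurable (\<Pi>\<^sub>M i\<in>{..<N}. borel)"
  unfolding scalar_prod_def by measurable

lemma std_gaussian_component:
  assumes "i < N"
  shows "distr (std_gaussian N) borel (\<lambda>g. g i) = std_normal"
proof -
  interpret product_prob_space "\<lambda>_. std_normal" "{..<N}"
    by (intro product_prob_spaceI prob_space_std_normal)
  have "distr (std_gaussian N) std_normal (\<lambda>g. g i) = std_normal"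
    unfolding std_gaussian_def using PiM_component[of i] assms by simp
  moreover have "distr (std_gaussian N) borel (\<lambda>g. g i) = distr (std_gaussian N) std_normal (\<lambda>g. g i)"
    by (rule distr_cong) auto
  ultimately show ?thesis by simp
qed

lemma std_gaussian_component_distributed:
  assumes "i < N"
  shows "distributed (std_gaussian N) lborel (\<lambda>g. g i) std_normal_density"
proof -
  have "distr (std_gaussian N) lborel (\<lambda>g. g i) = distr (std_gaussian N) borel (\<lambda>g. g i)"
    by (rule distr_cong) auto
  moreover have "(\<lambda>g. g i) \<in> borel_measurable (std_gaussian N)"
    using measurable_component_singleton[of i "{..<N}" "\<lambda>_. borel :: real measure"] assms
    by (simp cong: measurable_cong_sets add: sets_std_gaussian)
  ultimately show ?thesis
    unfolding distributed_def using std_gaussian_component[OF assms] by simp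
qed

lemma std_gaussian_indep:
  assumes "N \<ge> 1"
  shows "prob_space.indep_vars (std_gaussian N) (\<lambda>_. borel) (\<lambda>i g. g i) {..<N}"
proof -
  interpret prob_space "std_gaussian N" by (rule prob_space_std_gaussian)
  have "distr (std_gaussian N) (\<Pi>\<^sub>M i\<in>{..<N}. borel) (\<lambda>g. \<lambda>i\<in>{..<N}. g i)
     = distr (std_gaussian N) (std_gaussian N) (\<lambda>g. g)"
    by (rule distr_cong) (auto simp: sets_std_gaussian space_std_gaussian PiE_restrict)
  also have "\<dots> = std_gaussian N" by (simp add: distr_id2)
  also have "\<dots> = (\<Pi>\<^sub>M i\<in>{..<N}. distr (std_gaussian N) borel (\<lambda>g. g i))"
    unfolding std_gaussian_def
    by (rule PiM_cong) (auto simp: std_gaussian_component[unfolded std_gaussian_def])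
  finally show ?thesis
    using assms by (subst indep_vars_iff_distr_eq_PiM') (auto simp: lessThan_empty_iff)
qed

lemma std_gaussian_linear_distributed:
  assumes "(\<Sum>i<N. (v i)\<^sup>2) > 0"
  shows "distributed (std_gaussian N) lborel (\<lambda>g. scalar_prod N g v)
    (normal_density 0 (sqrt (\<Sum>i<N. (v i)\<^sup>2)))"
proof -
  interpret prob_space "std_gaussian N" by (rule prob_space_std_gaussian)
  \<comment> \<open>Sums of independent normals are available for a nonempty index set and positive
    standard deviations, so zero coefficients are discarded first.\<close>
  define I where "I = {i. i < N \<and> v i \<noteq> 0}"
  have I: "I \<subseteq> {..<N}" "finite I" by (auto simp: I_def)
  have ne: "I \<noteq> {}"
  proof
    assume "I = {}"
    then have "(\<Sum>i<N. (v i)\<^sup>2) = 0" by (intro sum.neutral) (auto simp: I_def)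
    with assms show False by simp
  qed
  then have N: "N \<ge> 1" by (auto simp: I_def)
  have ind: "indep_vars (\<lambda>_. borel) (\<lambda>i g. v i * g i) I"
    by (rule indep_vars_compose2[where X = "\<lambda>i g. g i" and M' = "\<lambda>_. borel",
          OF indep_vars_subset[OF std_gaussian_indep[OF N] I(1)]]) auto
  have nrm: "distributed (std_gaussian N) lborel (\<lambda>g. v i * g i) (normal_density 0 \<bar>v i\<bar>)"
    if "i \<in> I" for i
    using normal_density_affine[OF std_gaussian_component_distributed[of i N], of "v i" 0] that
    by (auto simp: I_def)
  have "distributed (std_gaussian N) lborel (\<lambda>x. \<Sum>i\<in>I. v i * x i)
      (normal_density (\<Sum>i\<in>I. 0) (sqrt (\<Sum>i\<in>I. \<bar>v i\<bar>\<^sup>2)))"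
    by (rule sum_indep_normal) (use I ne ind nrm in \<open>auto simp: I_def\<close>)
  moreover have "(\<Sum>i\<in>I. v i * x i) = scalar_prod N x v" for x
    unfolding scalar_prod_def
    by (rule sum.mono_neutral_cong_left) (auto simp: I_def)
  moreover have "(\<Sum>i\<in>I. \<bar>v i\<bar>\<^sup>2) = (\<Sum>i<N. (v i)\<^sup>2)"
    by (rule sum.mono_neutral_cong_left) (auto simp: I_def)
  ultimately show ?thesis by simp
qed

text \<open>Meant for the difference of two signed fields. This may vanish identically, hence the
  separate degenerate case.\<close>

lemma std_gaussian_abs_linear:
  shows "integrable (std_gaussian N) (\<lambda>g. \<bar>scalar_prod N g v\<bar>)" (is ?A)
    and "(\<integral>g. \<bar>scalar_prod N g v\<bar> \<partial>std_gaussian N) = sqrt (\<Sum>i<N. (v i)\<^sup>2) * sqrt (2 / pi)" (is ?B)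
proof -
  interpret prob_space "std_gaussian N" by (rule prob_space_std_gaussian)
  have "?A \<and> ?B"
  proof (cases "(\<Sum>i<N. (v i)\<^sup>2) > 0")
    case True
    note D = std_gaussian_linear_distributed[OF True]
    have s: "sqrt (\<Sum>i<N. (v i)\<^sup>2) > 0" using True by simp
    show ?thesis
      using distributed_integrable[OF D, of "\<lambda>x. \<bar>x\<bar>"] distributed_integral[OF D, of "\<lambda>x. \<bar>x\<bar>"]
        integrable_normal_moment_abs[OF s, of 0 1] integral_normal_moment_abs_odd[OF s, of 0 0]
      by (simp add: normal_density_nonneg)
  next
    case False
    then have "(\<Sum>i<N. (v i)\<^sup>2) = 0"
      by (meson antisym_conv2 linorder_not_less sum_nonneg zero_le_power2)
    then have "scalar_prod N g v = 0" for g
      by (auto simp: sum_nonneg_eq_0_iff scalar_prod_def)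
    then show ?thesis using \<open>(\<Sum>i<N. (v i)\<^sup>2) = 0\<close> by simp
  qed
  then show ?A ?B by auto
qed

lemma std_gaussian_unit_linear:
  fixes v :: "nat \<Rightarrow> real"
  assumes v: "(\<Sum>i<N. (v i)\<^sup>2) = 1"
  shows "integrable (std_gaussian N) (\<lambda>g. scalar_prod N g v)"
    and "(\<integral>g. scalar_prod N g v \<partial>std_gaussian N) = 0"
    and "integrable (std_gaussian N) (\<lambda>g. exp ((scalar_prod N g v)\<^sup>2 / 4))"
    and "(\<integral>g. exp ((scalar_prod N g v)\<^sup>2 / 4) \<partial>std_gaussian N) = sqrt 2"
proof -
  interpret prob_space "std_gaussian N" by (rule prob_space_std_gaussian)
  have D: "distributed (std_gaussian N) lborel (\<lambda>g. scalar_prod N g v) std_normal_density"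
    using std_gaussian_linear_distributed[of v N] v by simp
  show "integrable (std_gaussian N) (\<lambda>g. scalar_prod N g v)"
    using distributed_integrable[OF D, of "\<lambda>x. x"] integrable_std_normal_moment[of 1] by simp
  show "(\<integral>g. scalar_prod N g v \<partial>std_gaussian N) = 0"
    by (rule standard_normal_distributed_expectation[OF D])
  \<comment> \<open>The exponent - x^2 / 2 + x^2 / 4 = - x^2 / 4 belongs to a normal law of variance
    2, and sqrt 2 is the ratio of the two normalising constants.\<close>
  have eq: "std_normal_density x * exp (x\<^sup>2 / 4) = sqrt 2 * normal_density 0 (sqrt 2) x" for x
    unfolding normal_density_def
    by (simp add: exp_add[symmetric] real_sqrt_mult field_simps)
  show "integrable (std_gaussian N) (\<lambda>g. exp ((scalar_prod N g v)\<^sup>2 / 4))"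
    using distributed_integrable[OF D, of "\<lambda>x. exp (x\<^sup>2 / 4)"] by (simp add: eq)
  show "(\<integral>g. exp ((scalar_prod N g v)\<^sup>2 / 4) \<partial>std_gaussian N) = sqrt 2"
    using distributed_integral[OF D, of "\<lambda>x. exp (x\<^sup>2 / 4)"] by (simp add: eq)
qed

section \<open>Splitting a Gaussian vector into two independent ones\<close>

lemma std_normal_combine:
  assumes p: "0 < p" "p < 1"
  shows "distr (std_normal \<Otimes>\<^sub>M std_normal) borel (\<lambda>(x, y). sqrt p * x + sqrt (1 - p) * y) = std_normal"
proof -
  interpret P: prob_space std_normal by (rule prob_space_std_normal)
  interpret PP: pair_prob_space std_normal std_normal ..
  have "distr (std_normal \<Otimes>\<^sub>M std_normal) lborel fst = distr (std_normal \<Otimes>\<^sub>M std_normal) std_normal fst"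
    by (rule distr_cong) auto
  also have fst: "\<dots> = std_normal"
    by (rule P.distr_pair_fst)
  finally have D1: "distributed (std_normal \<Otimes>\<^sub>M std_normal) lborel fst std_normal_density"
    unfolding distributed_def by simp
  \<comment> \<open>The second marginal follows from the first, since swapping the factors preserves
    the product law.\<close>
  have "distr (std_normal \<Otimes>\<^sub>M std_normal) std_normal snd
      = distr (distr (std_normal \<Otimes>\<^sub>M std_normal) (std_normal \<Otimes>\<^sub>M std_normal) (\<lambda>(x, y). (y, x))) std_normal snd"
    by (subst PP.distr_pair_swap[symmetric]) simp
  also have "\<dots> = distr (std_normal \<Otimes>\<^sub>M std_normal) std_normal fst"
    by (subst distr_distr) (auto intro!: distr_cong)
  finally have snd: "distr (std_normal \<Otimes>\<^sub>M std_normal) std_normal snd = std_normal"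
    by (simp add: fst)
  have "distr (std_normal \<Otimes>\<^sub>M std_normal) lborel snd = distr (std_normal \<Otimes>\<^sub>M std_normal) std_normal snd"
    by (rule distr_cong) auto
  with snd have D2: "distributed (std_normal \<Otimes>\<^sub>M std_normal) lborel snd std_normal_density"
    unfolding distributed_def by simp
  have ind: "PP.indep_var std_normal fst std_normal snd"
    unfolding PP.indep_var_distribution_eq fst snd by (auto simp: distr_id2)
  have ind': "PP.indep_var borel (\<lambda>z. sqrt p * fst z) borel (\<lambda>z. sqrt (1 - p) * snd z)"
    using PP.indep_var_compose[OF ind, of "\<lambda>x. sqrt p * x" borel "\<lambda>x. sqrt (1 - p) * x" borel]
    by (simp add: o_def)
  have "distributed (std_normal \<Otimes>\<^sub>M std_normal) lborel
      (\<lambda>z. sqrt p * fst z + sqrt (1 - p) * snd z)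
      (normal_density (0 + 0) (sqrt ((sqrt p)\<^sup>2 + (sqrt (1 - p))\<^sup>2)))"
    using p PP.normal_density_affine[OF D1, of "sqrt p" 0] PP.normal_density_affine[OF D2, of "sqrt (1 - p)" 0]
    by (intro PP.add_indep_normal[OF ind']) auto
  then have "distributed (std_normal \<Otimes>\<^sub>M std_normal) lborel
      (\<lambda>z. sqrt p * fst z + sqrt (1 - p) * snd z) std_normal_density"
    using p by simp
  then have "distr (std_normal \<Otimes>\<^sub>M std_normal) lborel (\<lambda>z. sqrt p * fst z + sqrt (1 - p) * snd z) = std_normal"
    unfolding distributed_def by simp
  moreover have "distr (std_normal \<Otimes>\<^sub>M std_normal) lborel (\<lambda>z. sqrt p * fst z + sqrt (1 - p) * snd z)
     = distr (std_normal \<Otimes>\<^sub>M std_normal) borel (\<lambda>(x, y). sqrt p * x + sqrt (1 - p) * y)"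
    by (rule distr_cong) auto
  ultimately show ?thesis by simp
qed

text \<open>This is what allows the vector to be revealed in independent steps. A product measure is
  determined by its values on boxes; there, Fubini reduces the claim to a product over coordinates
  of the one-dimensional identity.\<close>

lemma std_gaussian_combine:
  assumes p: "0 < p" "p < 1"
  shows "distr (std_gaussian N \<Otimes>\<^sub>M std_gaussian N) (std_gaussian N)
    (\<lambda>(g, h). \<lambda>i\<in>{..<N}. sqrt p * g i + sqrt (1 - p) * h i) = std_gaussian N"
proof -
  interpret G: prob_space "std_gaussian N" by (rule prob_space_std_gaussian)
  interpret S: prob_space std_normal by (rule prob_space_std_normal)
  interpret SS: pair_prob_space std_normal std_normal ..
  interpret product_prob_space "\<lambda>_. std_normal" "{..<N}"
    by (intro product_prob_spaceI prob_space_std_normal)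
  let ?c = "\<lambda>(g :: nat \<Rightarrow> real, h :: nat \<Rightarrow> real). \<lambda>i\<in>{..<N}. sqrt p * g i + sqrt (1 - p) * h i"
  have c [measurable]: "?c \<in> std_gaussian N \<Otimes>\<^sub>M std_gaussian N \<rightarrow>\<^sub>M std_gaussian N"
    by measurable
  have "distr (std_gaussian N \<Otimes>\<^sub>M std_gaussian N) (std_gaussian N) ?c = PiM {..<N} (\<lambda>_. std_normal)"
  proof (rule PiM_eqI)
    fix A :: "nat \<Rightarrow> real set"
    assume A: "\<And>i. i \<in> {..<N} \<Longrightarrow> A i \<in> sets std_normal"
    then have A' [measurable]: "\<And>i. i \<in> {..<N} \<Longrightarrow> A i \<in> sets borel" by simp
    have box: "Pi\<^sub>E {..<N} A \<in> sets (std_gaussian N)"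
      unfolding std_gaussian_def using A by (intro sets_PiM_I_finite) auto
    have slice: "{y. sqrt p * x + sqrt (1 - p) * y \<in> A i} \<in> sets borel" if "i < N" for x i
      using measurable_sets_borel[of "\<lambda>y. sqrt p * x + sqrt (1 - p) * y" borel "A i"] A'[of i] that
      by (simp add: vimage_def)
    have "emeasure (distr (std_gaussian N \<Otimes>\<^sub>M std_gaussian N) (std_gaussian N) ?c) (Pi\<^sub>E {..<N} A)
      = emeasure (std_gaussian N \<Otimes>\<^sub>M std_gaussian N)
          (?c -` Pi\<^sub>E {..<N} A \<inter> space (std_gaussian N \<Otimes>\<^sub>M std_gaussian N))"
      using box by (subst emeasure_distr) auto
    also have "\<dots> = (\<integral>\<^sup>+g. emeasure (std_gaussian N)
        (Pair g -` (?c -` Pi\<^sub>E {..<N} A \<inter> space (std_gaussian N \<Otimes>\<^sub>M std_gaussian N))) \<partial>std_gaussian N)"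
      using box by (intro G.emeasure_pair_measure_alt measurable_sets[OF c])
    also have "\<dots> = (\<integral>\<^sup>+g. (\<Prod>i<N. emeasure std_normal {y. sqrt p * g i + sqrt (1 - p) * y \<in> A i}) \<partial>std_gaussian N)"
    proof (rule nn_integral_cong)
      fix g assume g: "g \<in> space (std_gaussian N)"
      have "Pair g -` (?c -` Pi\<^sub>E {..<N} A \<inter> space (std_gaussian N \<Otimes>\<^sub>M std_gaussian N))
        = (\<Pi>\<^sub>E i\<in>{..<N}. {y. sqrt p * g i + sqrt (1 - p) * y \<in> A i})"
      proof (intro set_eqI)
        fix h
        have "g \<in> extensional {..<N}" using g by (simp add: space_std_gaussian PiE_iff)
        then show "h \<in> Pair g -` (?c -` Pi\<^sub>E {..<N} A \<inter> space (std_gaussian N \<Otimes>\<^sub>M std_gaussian N))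
          \<longleftrightarrow> h \<in> (\<Pi>\<^sub>E i\<in>{..<N}. {y. sqrt p * g i + sqrt (1 - p) * y \<in> A i})"
          by (simp only: vimage_eq Int_iff space_pair_measure mem_Times_iff space_std_gaussian PiE_iff
              split fst_conv snd_conv restrict_extensional restrict_apply' UNIV_I mem_Collect_eq ball_simps simp_thms
              cong: ball_cong) blast
      qed
      then show "emeasure (std_gaussian N)
        (Pair g -` (?c -` Pi\<^sub>E {..<N} A \<inter> space (std_gaussian N \<Otimes>\<^sub>M std_gaussian N)))
        = (\<Prod>i<N. emeasure std_normal {y. sqrt p * g i + sqrt (1 - p) * y \<in> A i})"
        unfolding std_gaussian_def by (simp only:) (rule emeasure_PiM, auto simp: slice)
    qed
    also have "\<dots> = (\<Prod>i<N. \<integral>\<^sup>+x. emeasure std_normal {y. sqrt p * x + sqrt (1 - p) * y \<in> A i} \<partial>std_normal)"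
      unfolding std_gaussian_def
    proof (rule product_nn_integral_prod)
      fix i assume i: "i \<in> {..<N}"
      have "(\<lambda>x. emeasure std_normal (Pair x -` {z \<in> space (std_normal \<Otimes>\<^sub>M std_normal).
          sqrt p * fst z + sqrt (1 - p) * snd z \<in> A i})) \<in> borel_measurable std_normal"
        by (rule S.measurable_emeasure_Pair) (use A'[OF i] in measurable)
      then show "(\<lambda>x. emeasure std_normal {y. sqrt p * x + sqrt (1 - p) * y \<in> A i}) \<in> borel_measurable std_normal"
        by (simp only: space_pair_measure space_density space_lborel space_borel vimage_Collect_eq
            mem_Times_iff fst_conv snd_conv UNIV_I simp_thms)
    qed simp
    also have "\<dots> = (\<Prod>i<N. emeasure std_normal (A i))"
    proof (rule prod.cong[OF refl])
      fix i assume i: "i \<in> {..<N}"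
      note [measurable] = A'[OF i]
      have "emeasure std_normal (A i)
        = emeasure (distr (std_normal \<Otimes>\<^sub>M std_normal) borel (\<lambda>(x, y). sqrt p * x + sqrt (1 - p) * y)) (A i)"
        by (simp add: std_normal_combine[OF p])
      also have "\<dots> = emeasure (std_normal \<Otimes>\<^sub>M std_normal)
         {z \<in> space (std_normal \<Otimes>\<^sub>M std_normal). sqrt p * fst z + sqrt (1 - p) * snd z \<in> A i}"
        using A'[OF i] by (subst emeasure_distr) (auto intro!: arg_cong[where f = "emeasure _"])
      also have "\<dots> = (\<integral>\<^sup>+x. emeasure std_normal (Pair x -` {z \<in> space (std_normal \<Otimes>\<^sub>M std_normal).
          sqrt p * fst z + sqrt (1 - p) * snd z \<in> A i}) \<partial>std_normal)"
        by (rule S.emeasure_pair_measure_alt) measurable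
      finally show "(\<integral>\<^sup>+x. emeasure std_normal {y. sqrt p * x + sqrt (1 - p) * y \<in> A i} \<partial>std_normal)
          = emeasure std_normal (A i)"
        by (simp only: space_pair_measure space_density space_lborel space_borel vimage_Collect_eq
            mem_Times_iff fst_conv snd_conv UNIV_I simp_thms)
    qed
    finally show "emeasure (distr (std_gaussian N \<Otimes>\<^sub>M std_gaussian N) (std_gaussian N) ?c) (Pi\<^sub>E {..<N} A)
       = (\<Prod>i\<in>{..<N}. emeasure std_normal (A i))" .
  qed (auto simp: std_gaussian_def)
  then show ?thesis by (simp add: std_gaussian_def)
qed

section \<open>The expected potential of a pair\<close>

text \<open>Convexity replaces exp (u s) by the chord (1 - u) + u exp s, and u^2 <= u gives exp (q
  u^2) <= exp q exp (- q (1 - u)). The weight 1 - u of the chord is large only where this last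
  factor is small: their product is at most 1 / q.\<close>

lemma exp_interpolation:
  fixes q u s :: real
  assumes q: "q > 0" and u: "0 \<le> u" "u \<le> 1"
  shows "exp (q * u\<^sup>2 + u * s) \<le> exp q * (exp s + 1 / q)"
proof -
  have conv: "exp (u * s) \<le> (1 - u) + u * exp s"
    using convex_onD[OF exp_convex, of u 0 s] u by simp
  have "u\<^sup>2 \<le> u" using u by (simp add: power2_eq_square mult_left_le)
  then have "exp (q * u\<^sup>2) \<le> exp (q - q * (1 - u))"
    using q by (simp add: algebra_simps)
  also have "\<dots> = exp q * exp (- (q * (1 - u)))" by (simp add: exp_diff exp_minus field_simps)
  finally have 1: "exp (q * u\<^sup>2) \<le> exp q * exp (- (q * (1 - u)))" .
  have le1: "exp (- (q * (1 - u))) \<le> 1" using q u by simp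
  have "q * (1 - u) \<le> exp (q * (1 - u))"
    using exp_ge_add_one_self[of "q * (1 - u)"] by linarith
  then have "exp (- (q * (1 - u))) * (q * (1 - u)) \<le> exp (- (q * (1 - u))) * exp (q * (1 - u))"
    by (intro mult_left_mono) auto
  then have 2: "exp (- (q * (1 - u))) * (1 - u) \<le> 1 / q"
    using q by (simp add: exp_add[symmetric] pos_le_divide_eq mult_ac)
  have 3: "exp (- (q * (1 - u))) * (u * exp s) \<le> exp s"
  proof -
    have "exp (- (q * (1 - u))) * u \<le> 1 * 1" by (intro mult_mono le1 u) (use u in auto)
    then show ?thesis by (simp add: mult.assoc[symmetric])
  qed
  have "exp (q * u\<^sup>2 + u * s) = exp (q * u\<^sup>2) * exp (u * s)" by (simp add: exp_add)
  also have "\<dots> \<le> (exp q * exp (- (q * (1 - u)))) * ((1 - u) + u * exp s)"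
    by (intro mult_mono 1 conv) auto
  also have "\<dots> = exp q * (exp (- (q * (1 - u))) * (u * exp s) + exp (- (q * (1 - u))) * (1 - u))"
    by (simp add: algebra_simps)
  also have "\<dots> \<le> exp q * (exp s + 1 / q)"
    by (intro mult_left_mono add_mono 2 3) auto
  finally show ?thesis .
qed

text \<open>
  Here \<open>\<epsilon>\<close> is the sign of \<open>y\<close>. The interpolation inequality reduces to the extreme case
  \<open>\<bar>y\<bar> = z\<close>, where the exponent is essentially linear in \<open>x\<close>, at the price of the error \<open>1 / z\<^sup>2\<close>.
\<close>
lemma exp_square_shift_le:
  fixes y z l \<epsilon> x :: real
  assumes y: "\<bar>y\<bar> \<le> z" and z: "z > 0" and l: "l > 0" and p: "(l / z)\<^sup>2 < 1"
    and s: "\<epsilon> * y = \<bar>y\<bar>" "\<epsilon>\<^sup>2 = 1"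
  defines "p \<equiv> (l / z)\<^sup>2"
  shows "exp ((y + sqrt p * x)\<^sup>2 / (1 - p))
    \<le> exp (z\<^sup>2) * exp (l\<^sup>2 / (1 - p)) * (exp (p / (1 - p) * x\<^sup>2) * (exp (2 * l / (1 - p) * (\<epsilon> * x)) + 1 / z\<^sup>2))"
proof -
  define u where "u = \<bar>y\<bar> / z"
  define q where "q = z\<^sup>2 / (1 - p)"
  have p1: "0 < 1 - p" "0 \<le> p" using p by (auto simp: p_def)
  have u: "0 \<le> u" "u \<le> 1" using y z by (auto simp: u_def)
  have q: "q > 0" using p1 z by (simp add: q_def)
  have qz: "z\<^sup>2 \<le> q"
  proof -
    have "z\<^sup>2 * (1 - p) \<le> z\<^sup>2" using p1 by (simp add: mult_left_le)
    then show ?thesis using p1 by (simp add: q_def field_simps)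
  qed
  have sp: "sqrt p = l / z" using l z by (simp add: p_def)
  have yeq: "y = \<epsilon> * \<bar>y\<bar>" using s by (metis mult.assoc mult_1 power2_eq_square)
  \<comment> \<open>With \<open>u\<close> the relative size of \<open>y\<close>, the exponent is a
    quadratic in \<open>u\<close> fit for \<open>exp_interpolation\<close>, plus a term in x^2
    alone. The signed displacement \<open>\<epsilon> * x\<close> is positive when it points away
    from the middle.\<close>
  have eq: "(y + sqrt p * x)\<^sup>2 / (1 - p) = (q * u\<^sup>2 + u * (2 * l / (1 - p) * (\<epsilon> * x))) + p / (1 - p) * x\<^sup>2"
  proof -
    have "(y + sqrt p * x)\<^sup>2 = \<bar>y\<bar>\<^sup>2 + 2 * (y * sqrt p * x) + p * x\<^sup>2"
      using p1 by (simp add: power2_sum power_mult_distrib)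
    also have "y * sqrt p * x = u * l * (\<epsilon> * x)"
      using yeq z by (simp add: sp u_def field_simps)
    also have "\<bar>y\<bar>\<^sup>2 = z\<^sup>2 * u\<^sup>2" using z by (simp add: u_def power_divide)
    finally show ?thesis using p1
      by (simp add: q_def add_divide_distrib[symmetric] algebra_simps)
  qed
  \<comment> \<open>Since z^2 p = l^2, the choice of \<open>p\<close> makes the rescaling by 1 / (1
    - p) cost only the factor exp (l^2 / (1 - p)), however large \<open>z\<close> is.\<close>
  have qeq: "q = z\<^sup>2 + l\<^sup>2 / (1 - p)"
  proof -
    have "z\<^sup>2 * p = l\<^sup>2" using z by (simp add: p_def power_divide)
    then have "z\<^sup>2 = z\<^sup>2 * (1 - p) + l\<^sup>2" by (simp add: algebra_simps)
    then show ?thesis using p1 unfolding q_def by (metis add_divide_distrib less_irrefl nonzero_mult_div_cancel_right)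
  qed
  have "1 / q \<le> 1 / z\<^sup>2" using qz z by (simp add: frac_le)
  then have "exp (q * u\<^sup>2 + u * (2 * l / (1 - p) * (\<epsilon> * x)))
     \<le> exp q * (exp (2 * l / (1 - p) * (\<epsilon> * x)) + 1 / z\<^sup>2)"
    using exp_interpolation[OF q u, of "2 * l / (1 - p) * (\<epsilon> * x)"]
    by (smt (verit) exp_gt_zero mult_left_mono)
  then show ?thesis
    unfolding eq exp_add[of _ "p / (1 - p) * x\<^sup>2"] using qeq
    by (simp add: exp_add mult_right_mono mult_ac)
qed

text \<open>Second-order expansion in the small parameters; \<open>s\<close> will be the smaller of
  two signed displacements and \<open>m\<close> the larger of their moduli. The linear term is kept
  exactly because its mean is the drift; all the rest is absorbed by exp (m^2 / 4), which is still
  integrable.\<close>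

lemma exp_min_le:
  fixes l m s \<kappa> w :: real
  assumes l: "0 \<le> l" "l \<le> 1/8" and k: "0 \<le> \<kappa>" "\<kappa> \<le> 1/8" and w: "0 \<le> w"
    and m: "\<bar>s\<bar> \<le> m"
  shows "exp (\<kappa> * m\<^sup>2) * (exp (l * s) + w) \<le> 1 + l * s + 32 * (l\<^sup>2 + \<kappa> + w) * exp (m\<^sup>2 / 4)"
proof -
  have m0: "0 \<le> m" using m by linarith
  have E: "exp x \<le> 1 + x + x\<^sup>2 * exp \<bar>x\<bar>" for x :: real
  proof (cases "x \<ge> 0")
    case True
    have "exp x - 1 \<le> x * exp x"
      using exp_ge_add_one_self[of "-x"] by (simp add: exp_minus field_simps)
    then have "exp x \<le> 1 + x * exp x" by simp
    moreover have "x * exp x \<le> x * (1 + x * exp x)" using True calculation by (intro mult_left_mono) auto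
    ultimately show ?thesis using True by (simp add: power2_eq_square algebra_simps)
  next
    case False
    then have x: "x < 0" by simp
    have "1 + (- x) \<le> exp (- x)" by (rule exp_ge_add_one_self)
    then have "exp x \<le> 1 / (1 - x)" using x by (simp add: exp_minus field_simps)
    also have "\<dots> \<le> 1 + x + x\<^sup>2" 
    proof -
      have "1 \<le> (1 + x + x\<^sup>2) * (1 - x)"
        using x by (simp add: algebra_simps power2_eq_square power3_eq_cube mult_nonneg_nonpos2 zero_le_mult_iff mult_le_0_iff)
      then show ?thesis using x by (simp add: field_simps)
    qed
    also have "\<dots> \<le> 1 + x + x\<^sup>2 * exp \<bar>x\<bar>" using mult_left_mono[of 1 "exp \<bar>x\<bar>" "x\<^sup>2"] by simp
    finally show ?thesis .
  qed
  have ls: "\<bar>l * s\<bar> \<le> l * m" using l m by (simp add: abs_mult mult_left_mono)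
  have 1: "exp (l * s) \<le> 1 + l * s + l\<^sup>2 * m\<^sup>2 * exp (l * m)"
  proof -
    have "(l * s)\<^sup>2 \<le> (l * m)\<^sup>2" using ls by (metis abs_ge_zero power2_abs power_mono)
    then have "(l * s)\<^sup>2 * exp \<bar>l * s\<bar> \<le> (l * m)\<^sup>2 * exp (l * m)"
      using ls by (intro mult_mono) auto
    then show ?thesis using E[of "l * s"] by (simp add: power_mult_distrib)
  qed
  have 2: "exp (\<kappa> * m\<^sup>2) - 1 \<le> \<kappa> * m\<^sup>2 * exp (\<kappa> * m\<^sup>2)"
    using exp_ge_add_one_self[of "- (\<kappa> * m\<^sup>2)"] by (simp add: exp_minus field_simps)
  have km: "\<kappa> * m\<^sup>2 \<le> m\<^sup>2 / 8" using mult_right_mono[OF k(2), of "m\<^sup>2"] by simp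
  have lm: "l * m \<le> m\<^sup>2 / 16 + 1 / 16"
  proof -
    have "l * m \<le> 1/8 * m" using l m0 by (intro mult_right_mono) auto
    moreover have "2 * m \<le> m\<^sup>2 + 1" using zero_le_power2[of "m - 1"] by (simp add: power2_diff)
    ultimately show ?thesis by simp
  qed
  \<comment> \<open>The exponent on the left is at most 3 m^2 / 16 + 1 / 16. The spare m^2 / 16
    absorbs the factor m^2 at the cost of 16, and exp (1 / 16) costs at most 2.\<close>
  have m2: "m\<^sup>2 * exp (m\<^sup>2 / 8 + l * m) \<le> 32 * exp (m\<^sup>2 / 4)"
  proof -
    have a: "m\<^sup>2 \<le> 16 * exp (m\<^sup>2 / 16)" using exp_ge_add_one_self[of "m\<^sup>2 / 16"] by linarith
    have "exp (1 / 16 :: real) \<le> 2"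
      using exp_bound[of "1/16"] by (simp add: power2_eq_square)
    then have "exp (m\<^sup>2 / 8 + l * m) \<le> exp (m\<^sup>2 / 8 + m\<^sup>2 / 16) * 2"
    proof -
      have "exp (m\<^sup>2 / 8 + l * m) \<le> exp (m\<^sup>2 / 8 + m\<^sup>2 / 16 + 1 / 16)" using lm by simp
      also have "\<dots> = exp (m\<^sup>2 / 8 + m\<^sup>2 / 16) * exp (1 / 16)" by (rule exp_add)
      also have "\<dots> \<le> exp (m\<^sup>2 / 8 + m\<^sup>2 / 16) * 2"
        using \<open>exp (1 / 16 :: real) \<le> 2\<close> by (intro mult_left_mono) auto
      finally show ?thesis .
    qed
    then have "m\<^sup>2 * exp (m\<^sup>2 / 8 + l * m) \<le> (16 * exp (m\<^sup>2 / 16)) * (exp (m\<^sup>2 / 8 + m\<^sup>2 / 16) * 2)"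
      using a by (intro mult_mono) auto
    also have "\<dots> = 32 * exp (m\<^sup>2 / 16 + (m\<^sup>2 / 8 + m\<^sup>2 / 16))" by (simp only: exp_add)
    also have "m\<^sup>2 / 16 + (m\<^sup>2 / 8 + m\<^sup>2 / 16) = m\<^sup>2 / 4" by simp
    finally show ?thesis .
  qed
  have "exp (\<kappa> * m\<^sup>2) * exp (l * s) = exp (l * s) + (exp (\<kappa> * m\<^sup>2) - 1) * exp (l * s)"
    by (simp add: algebra_simps)
  also have "(exp (\<kappa> * m\<^sup>2) - 1) * exp (l * s) \<le> (\<kappa> * m\<^sup>2 * exp (m\<^sup>2 / 8)) * exp (l * m)"
  proof (intro mult_mono)
    show "exp (\<kappa> * m\<^sup>2) - 1 \<le> \<kappa> * m\<^sup>2 * exp (m\<^sup>2 / 8)"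
      using 2 km k mult_left_mono[of "exp (\<kappa> * m\<^sup>2)" "exp (m\<^sup>2 / 8)" "\<kappa> * m\<^sup>2"] by auto
  qed (use ls k in auto)
  also have "\<dots> = \<kappa> * (m\<^sup>2 * exp (m\<^sup>2 / 8 + l * m))" by (simp add: exp_add)
  also have "\<dots> \<le> \<kappa> * (32 * exp (m\<^sup>2 / 4))" by (intro mult_left_mono m2 k)
  finally have A: "exp (\<kappa> * m\<^sup>2) * exp (l * s) \<le> exp (l * s) + \<kappa> * (32 * exp (m\<^sup>2 / 4))" by simp
  have "l\<^sup>2 * m\<^sup>2 * exp (l * m) \<le> l\<^sup>2 * (m\<^sup>2 * exp (m\<^sup>2 / 8 + l * m))"
    by (simp add: mult_left_mono mult.assoc)
  also have "\<dots> \<le> l\<^sup>2 * (32 * exp (m\<^sup>2 / 4))" by (intro mult_left_mono m2) auto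
  finally have B: "exp (l * s) \<le> 1 + l * s + l\<^sup>2 * (32 * exp (m\<^sup>2 / 4))" using 1 by simp
  have "exp (\<kappa> * m\<^sup>2) \<le> exp (m\<^sup>2 / 4)"
    unfolding exp_le_cancel_iff using km zero_le_power2[of m] by linarith
  then have "exp (\<kappa> * m\<^sup>2) \<le> 32 * exp (m\<^sup>2 / 4)"
    using exp_gt_zero[of "m\<^sup>2 / 4"] by linarith
  then have "exp (\<kappa> * m\<^sup>2) * w \<le> 32 * exp (m\<^sup>2 / 4) * w"
    using w by (intro mult_right_mono) auto
  then show ?thesis using A B by (simp add: algebra_simps)
qed

text \<open>The smaller potential is controlled by the smaller signed displacement, and twice a
  minimum is the sum minus the modulus of the difference: the sum will average to zero and the
  difference yields the drift. The condition \<open>z \<ge> 1 / l\<close> brings the interpolation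
  error 1 / z^2 down to l^2.\<close>

lemma min_exp_square_shift_le:
  fixes y y' z l \<epsilon> \<epsilon>' x x' :: real
  assumes y: "\<bar>y\<bar> \<le> z" "\<bar>y'\<bar> \<le> z" and l: "0 < l" "l \<le> 1/32" and z: "z \<ge> 1 / l"
    and s: "\<epsilon> * y = \<bar>y\<bar>" "\<epsilon>\<^sup>2 = 1" and s': "\<epsilon>' * y' = \<bar>y'\<bar>" "\<epsilon>'\<^sup>2 = 1"
  defines "p \<equiv> (l / z)\<^sup>2"
  shows "min (exp ((y + sqrt p * x)\<^sup>2 / (1 - p))) (exp ((y' + sqrt p * x')\<^sup>2 / (1 - p)))
    \<le> exp (z\<^sup>2) * (exp (2 * l\<^sup>2) * (1 + l / (1 - p) * (\<epsilon> * x + \<epsilon>' * x') - l / (1 - p) * \<bar>\<epsilon> * x - \<epsilon>' * x'\<bar>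
       + 576 * l\<^sup>2 * (exp (x\<^sup>2 / 4) + exp (x'\<^sup>2 / 4))))"
proof -
  have z0: "z > 0" using l z by (smt (verit) divide_pos_pos)
  have l1: "l\<^sup>2 \<le> 1/1024" using l power_mono[of l "1/32" 2] by (simp add: power_divide)
  have iz: "1 / z\<^sup>2 \<le> l\<^sup>2"
  proof -
    have "1 \<le> l * z" using z l by (simp add: field_simps)
    then have "1 \<le> (l * z)\<^sup>2" by (rule one_le_power)
    then show ?thesis using z0 by (simp add: power_mult_distrib field_simps)
  qed
  have pl: "p \<le> l\<^sup>2 * l\<^sup>2"
    using mult_left_mono[OF iz, of "l\<^sup>2"] by (simp add: p_def power_divide)
  also have "\<dots> \<le> l\<^sup>2 * (1/1024)" using l1 by (intro mult_left_mono) auto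
  finally have pl2: "p \<le> l\<^sup>2 / 1024" by simp
  have p0: "0 \<le> p" and p1: "p \<le> 1/2" using pl2 l1 by (auto simp: p_def)
  define L where "L = 2 * l / (1 - p)"
  define k where "k = p / (1 - p)"
  have ip: "1 / (1 - p) \<le> 2" "0 < 1 - p" using p1 by (auto simp: field_simps)
  have L: "0 \<le> L" "L \<le> 4 * l"
    using mult_left_mono[OF ip(1), of "2 * l"] ip l by (auto simp: L_def)
  have L8: "L \<le> 1/8" using L l by linarith
  have k: "0 \<le> k" "k \<le> l\<^sup>2"
    using mult_left_mono[OF ip(1), of p] ip p0 pl2 by (auto simp: k_def)
  have k8: "k \<le> 1/8" using k l1 by linarith
  have el: "exp (l\<^sup>2 / (1 - p)) \<le> exp (2 * l\<^sup>2)"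
    using mult_left_mono[OF ip(1), of "l\<^sup>2"] by simp
  have p': "(l / z)\<^sup>2 < 1" using p1 by (simp add: p_def)
  define m where "m = max \<bar>x\<bar> \<bar>x'\<bar>"
  define t where "t = min (\<epsilon> * x) (\<epsilon>' * x')"
  have es: "\<bar>\<epsilon>\<bar> = 1" "\<bar>\<epsilon>'\<bar> = 1" using s s' by (auto simp: power2_eq_1_iff)
  have tm: "\<bar>t\<bar> \<le> m" using es by (auto simp: t_def m_def min_def abs_mult)
  have x2: "x\<^sup>2 \<le> m\<^sup>2" "x'\<^sup>2 \<le> m\<^sup>2"
    unfolding m_def by (metis abs_ge_zero max.cobounded1 power2_abs power_mono)
      (metis abs_ge_zero max.cobounded2 power2_abs power_mono)
  \<comment> \<open>Replacing both displacements by \<open>m\<close> in the quadratic factor gives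
    bounds that differ only through \<open>e * a\<close>, so the smaller of the two is the bound at
    \<open>t\<close>.\<close>
  have one: "exp ((v + sqrt p * a)\<^sup>2 / (1 - p)) \<le> exp (z\<^sup>2) * (exp (2 * l\<^sup>2) * (exp (k * m\<^sup>2) * (exp (L * (e * a)) + 1 / z\<^sup>2)))"
    if "\<bar>v\<bar> \<le> z" "e * v = \<bar>v\<bar>" "e\<^sup>2 = 1" "a\<^sup>2 \<le> m\<^sup>2" for v e a
  proof -
    have "exp ((v + sqrt p * a)\<^sup>2 / (1 - p)) \<le> exp (z\<^sup>2) * (exp (l\<^sup>2 / (1 - p)) * (exp (k * a\<^sup>2) * (exp (L * (e * a)) + 1 / z\<^sup>2)))"
      using exp_square_shift_le[OF that(1) z0 l(1) p' that(2,3), of a]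
      unfolding p_def[symmetric] k_def L_def by (simp add: mult_ac)
    also have "\<dots> \<le> exp (z\<^sup>2) * (exp (2 * l\<^sup>2) * (exp (k * m\<^sup>2) * (exp (L * (e * a)) + 1 / z\<^sup>2)))"
      using k that(4) by (intro mult_left_mono mult_mono el order_refl)
        (auto simp: mult_left_mono intro: add_nonneg_nonneg)
    finally show ?thesis .
  qed
  have "min (exp ((y + sqrt p * x)\<^sup>2 / (1 - p))) (exp ((y' + sqrt p * x')\<^sup>2 / (1 - p)))
     \<le> exp (z\<^sup>2) * (exp (2 * l\<^sup>2) * (exp (k * m\<^sup>2) * (exp (L * t) + 1 / z\<^sup>2)))"
    using one[OF y(1) s x2(1)] one[OF y(2) s' x2(2)]
    by (cases "\<epsilon> * x \<le> \<epsilon>' * x'") (simp_all add: t_def min_le_iff_disj)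
  also have "\<dots> \<le> exp (z\<^sup>2) * (exp (2 * l\<^sup>2) * (1 + L * t + 32 * (L\<^sup>2 + k + 1 / z\<^sup>2) * exp (m\<^sup>2 / 4)))"
    using exp_min_le[OF L(1) L8 k(1) k8 _ tm, of "1 / z\<^sup>2"] by (intro mult_left_mono) auto
  \<comment> \<open>576 = 32 * (16 + 1 + 1): L^2 is at most 16 l^2, while \<open>k\<close> and 1 /
    z^2 are at most l^2 each.\<close>
  also have "\<dots> \<le> exp (z\<^sup>2) * (exp (2 * l\<^sup>2) * (1 + L * t + 576 * l\<^sup>2 * (exp (x\<^sup>2 / 4) + exp (x'\<^sup>2 / 4))))"
  proof -
    have "L\<^sup>2 \<le> 16 * l\<^sup>2" using power_mono[OF L(2) L(1), of 2] by (simp add: power_mult_distrib)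
    then have "L\<^sup>2 + k + 1 / z\<^sup>2 \<le> 16 * l\<^sup>2 + l\<^sup>2 + l\<^sup>2" using k(2) iz by (intro add_mono)
    then have a: "32 * (L\<^sup>2 + k + 1 / z\<^sup>2) \<le> 576 * l\<^sup>2" by simp
    have "exp (m\<^sup>2 / 4) \<le> exp (x\<^sup>2 / 4) + exp (x'\<^sup>2 / 4)" by (auto simp: m_def max_def)
    then have "32 * (L\<^sup>2 + k + 1 / z\<^sup>2) * exp (m\<^sup>2 / 4) \<le> 576 * l\<^sup>2 * (exp (x\<^sup>2 / 4) + exp (x'\<^sup>2 / 4))"
      by (intro mult_mono[OF a]) auto
    then show ?thesis by (intro mult_left_mono add_left_mono) auto
  qed
  also have "L * t = l / (1 - p) * (\<epsilon> * x + \<epsilon>' * x') - l / (1 - p) * \<bar>\<epsilon> * x - \<epsilon>' * x'\<bar>"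
  proof -
    have "2 * t = (\<epsilon> * x + \<epsilon>' * x') - \<bar>\<epsilon> * x - \<epsilon>' * x'\<bar>" by (auto simp: t_def min_def)
    then have "l / (1 - p) * (2 * t) = l / (1 - p) * ((\<epsilon> * x + \<epsilon>' * x') - \<bar>\<epsilon> * x - \<epsilon>' * x'\<bar>)" by simp
    then show ?thesis unfolding L_def by (simp add: right_diff_distrib mult_ac)
  qed
  finally show ?thesis by (simp add: add_diff_eq)
qed

text \<open>
  Two independent uniform points of \<open>S\<close> both avoid a sublevel set of density below \<open>c\<close> with
  probability more than \<open>(1 - c)\<^sup>2\<close>. This replaces a quantile of \<open>f\<close> by an expected minimum,
  which is accessible to Gaussian integration.
\<close>
lemma exists_large_sublevel:
  fixes f :: "'a \<Rightarrow> real"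
  assumes S: "finite S" "S \<noteq> {}" and f: "\<And>\<sigma>. \<sigma> \<in> S \<Longrightarrow> 0 \<le> f \<sigma>" and c: "0 < c" "c < 1"
  defines "q \<equiv> (\<Sum>\<sigma>\<in>S. \<Sum>\<tau>\<in>S. min (f \<sigma>) (f \<tau>)) / ((1 - c)\<^sup>2 * (real (card S))\<^sup>2)"
  shows "c * card S \<le> card {\<sigma> \<in> S. f \<sigma> \<le> q}"
proof (rule ccontr)
  assume neg: "\<not> ?thesis"
  define U where "U = {\<sigma> \<in> S. \<not> f \<sigma> \<le> q}"
  have fin: "finite U" "U \<subseteq> S" using S by (auto simp: U_def)
  have "card S = card {\<sigma> \<in> S. f \<sigma> \<le> q} + card U"
    unfolding U_def using S
    by (subst card_Un_disjoint[symmetric]) (auto intro!: arg_cong[where f = card])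
  with neg have cU: "real (card U) > (1 - c) * card S" by (simp add: algebra_simps)
  have cS: "card S > 0" using S by (simp add: card_gt_0_iff)
  have q0: "q \<ge> 0" unfolding q_def using f by (intro divide_nonneg_nonneg sum_nonneg) auto
  have U0: "U \<noteq> {}" using cU cS c by (auto simp: mult_less_0_iff)
  have "((1 - c) * card S)\<^sup>2 * q \<le> (real (card U))\<^sup>2 * q"
    using cU c q0 by (intro mult_right_mono power_mono) auto
  also have "\<dots> = (\<Sum>\<sigma>\<in>U. \<Sum>\<tau>\<in>U. q)" by (simp add: power2_eq_square)
  also have "\<dots> < (\<Sum>\<sigma>\<in>U. \<Sum>\<tau>\<in>U. min (f \<sigma>) (f \<tau>))"
    using fin U0 by (intro sum_strict_mono) (auto simp: U_def)
  also have "\<dots> \<le> (\<Sum>\<sigma>\<in>U. \<Sum>\<tau>\<in>S. min (f \<sigma>) (f \<tau>))"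
    using S fin f by (intro sum_mono sum_mono2) auto
  also have "\<dots> \<le> (\<Sum>\<sigma>\<in>S. \<Sum>\<tau>\<in>S. min (f \<sigma>) (f \<tau>))"
    using S fin f by (intro sum_mono2 sum_nonneg) auto
  also have "\<dots> = ((1 - c) * card S)\<^sup>2 * q"
    using c cS by (simp add: q_def power_mult_distrib)
  finally show False by simp
qed

section \<open>Overlaps in the hypercube\<close>

lemma finite_hypercube: "finite (hypercube N)"
  unfolding hypercube_def by (intro finite_PiE) auto

lemma hypercube_nth: "\<sigma> \<in> hypercube N \<Longrightarrow> i < N \<Longrightarrow> \<sigma> i = 1 \<or> \<sigma> i = -1"
  unfolding hypercube_def by (auto simp: PiE_iff)

text \<open>The exponential factorises over coordinates, and each coordinate contributes exp t + exp
  (- t) whatever the sign of \<open>\<sigma> i\<close>.\<close>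

lemma sum_exp_hypercube:
  assumes "\<sigma> \<in> hypercube N"
  shows "(\<Sum>\<tau>\<in>hypercube N. exp (t * scalar_prod N \<sigma> \<tau>)) = (exp t + exp (- t)) ^ N"
proof -
  have "(\<Sum>\<tau>\<in>hypercube N. exp (t * scalar_prod N \<sigma> \<tau>))
     = (\<Sum>\<tau>\<in>hypercube N. \<Prod>i<N. exp (t * (\<sigma> i * \<tau> i)))"
    by (simp add: scalar_prod_def sum_distrib_left exp_sum)
  also have "\<dots> = (\<Prod>i<N. \<Sum>x\<in>{-1,1}. exp (t * (\<sigma> i * x)))"
    unfolding hypercube_def by (rule prod_sum_PiE[symmetric]) auto
  also have "\<dots> = (\<Prod>i<N. exp t + exp (- t))"
    using hypercube_nth[OF assms] by (intro prod.cong refl) force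
  finally show ?thesis by simp
qed

text \<open>Chernoff bound for the overlap with a uniform point of the cube: per coordinate the
  count grows by a factor at most exp (t \<eta>) (1 + exp (- 2 t)), which is close to 1 for
  \<open>t\<close> large and then \<eta> small. The same \<eta> serves all dimensions.\<close>

lemma card_overlap_le:
  assumes \<delta>: "\<delta> > 0"
  obtains \<eta> :: real where "0 < \<eta>" "\<eta> < 1"
    "\<And>N \<sigma>. \<sigma> \<in> hypercube N \<Longrightarrow>
      real (card {\<tau> \<in> hypercube N. \<bar>scalar_prod N \<sigma> \<tau>\<bar> > (1 - \<eta>) * real N}) \<le> 2 * exp (real N * \<delta>)"
proof -
  \<comment> \<open>\<open>t\<close> makes exp (- 2 t) at most \<open>\<delta> / 2\<close>, then
    \<open>\<eta>\<close> makes t \<eta> at most \<open>\<delta> / 2\<close>; the two halves add up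
    to \<delta> in the exponent.\<close>
  define t where "t = max 1 (- ln (\<delta> / 2) / 2)"
  define \<eta> where "\<eta> = min (1/2) (\<delta> / (2 * t))"
  have t: "t \<ge> 1" by (simp add: t_def)
  have \<eta>: "0 < \<eta>" "\<eta> < 1" using \<delta> t by (auto simp: \<eta>_def)
  have t2: "exp (- 2 * t) \<le> \<delta> / 2"
  proof -
    have "- 2 * t \<le> ln (\<delta> / 2)" by (simp add: t_def max_def)
    then have "exp (- 2 * t) \<le> exp (ln (\<delta> / 2))" by (simp only: exp_le_cancel_iff)
    then show ?thesis using \<delta> by simp
  qed
  have te: "t * \<eta> \<le> \<delta> / 2"
  proof -
    have "t * \<eta> \<le> t * (\<delta> / (2 * t))" using t by (intro mult_left_mono) (auto simp: \<eta>_def)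
    then show ?thesis using t by simp
  qed
  have base: "exp (- (t * (1 - \<eta>))) * (exp t + exp (- t)) \<le> exp \<delta>"
  proof -
    have "exp (- (t * (1 - \<eta>))) * (exp t + exp (- t)) = exp (t * \<eta>) * (1 + exp (- 2 * t))"
      by (simp add: algebra_simps exp_add[symmetric])
    also have "\<dots> \<le> exp (\<delta> / 2) * exp (\<delta> / 2)"
    proof (intro mult_mono)
      show "1 + exp (- 2 * t) \<le> exp (\<delta> / 2)"
        using t2 exp_ge_add_one_self[of "\<delta> / 2"] by linarith
    qed (use te in \<open>auto intro: add_nonneg_nonneg\<close>)
    finally show ?thesis by (simp add: exp_add[symmetric])
  qed
  \<comment> \<open>One tail at a time: the sign \<open>e\<close> selects overlaps near N or near -
    N.\<close>
  have one: "real (card {\<tau> \<in> hypercube N. e * scalar_prod N \<sigma> \<tau> > (1 - \<eta>) * real N}) \<le> exp (real N * \<delta>)"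
    if \<sigma>: "\<sigma> \<in> hypercube N" and e: "e = 1 \<or> e = -1" for N \<sigma> and e :: real
  proof -
    let ?A = "{\<tau> \<in> hypercube N. e * scalar_prod N \<sigma> \<tau> > (1 - \<eta>) * real N}"
    have "real (card ?A) * exp (t * ((1 - \<eta>) * real N)) = (\<Sum>\<tau>\<in>?A. exp (t * ((1 - \<eta>) * real N)))"
      by simp
    also have "\<dots> \<le> (\<Sum>\<tau>\<in>?A. exp (t * e * scalar_prod N \<sigma> \<tau>))"
      using t by (intro sum_mono) (simp add: mult.assoc)
    also have "\<dots> \<le> (\<Sum>\<tau>\<in>hypercube N. exp (t * e * scalar_prod N \<sigma> \<tau>))"
      by (intro sum_mono2 finite_hypercube) auto
    also have "\<dots> = (exp t + exp (- t)) ^ N"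
      using sum_exp_hypercube[OF \<sigma>, of "t * e"] e by (auto simp: add.commute)
    finally have *: "real (card ?A) * exp (t * ((1 - \<eta>) * real N)) \<le> (exp t + exp (- t)) ^ N" .
    have "real (card ?A) = exp (- (t * ((1 - \<eta>) * real N))) * (real (card ?A) * exp (t * ((1 - \<eta>) * real N)))"
      by (simp add: exp_minus)
    also have "\<dots> \<le> exp (- (t * ((1 - \<eta>) * real N))) * (exp t + exp (- t)) ^ N"
      by (intro mult_left_mono *) auto
    also have "exp (- (t * ((1 - \<eta>) * real N))) = exp (- (t * (1 - \<eta>))) ^ N"
      by (simp add: exp_of_nat_mult[symmetric] mult_ac)
    finally have "real (card ?A) \<le> (exp (- (t * (1 - \<eta>))) * (exp t + exp (- t))) ^ N"
      by (simp only: power_mult_distrib)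
    also have "\<dots> \<le> exp \<delta> ^ N"
      using base by (intro power_mono) (auto intro: add_nonneg_nonneg)
    finally show ?thesis by (simp add: exp_of_nat_mult)
  qed
  have "real (card {\<tau> \<in> hypercube N. \<bar>scalar_prod N \<sigma> \<tau>\<bar> > (1 - \<eta>) * real N}) \<le> 2 * exp (real N * \<delta>)"
    if \<sigma>: "\<sigma> \<in> hypercube N" for N \<sigma>
  proof -
    let ?B = "\<lambda>e. {\<tau> \<in> hypercube N. e * scalar_prod N \<sigma> \<tau> > (1 - \<eta>) * real N}"
    have "{\<tau> \<in> hypercube N. \<bar>scalar_prod N \<sigma> \<tau>\<bar> > (1 - \<eta>) * real N} \<subseteq> ?B 1 \<union> ?B (-1)" by auto
    then have "card {\<tau> \<in> hypercube N. \<bar>scalar_prod N \<sigma> \<tau>\<bar> > (1 - \<eta>) * real N} \<le> card (?B 1 \<union> ?B (-1))"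
      by (intro card_mono finite_UnI finite_subset[OF _ finite_hypercube]) auto
    also have "\<dots> \<le> card (?B 1) + card (?B (-1))" by (rule card_Un_le)
    finally show ?thesis using one[OF \<sigma>, of 1] one[OF \<sigma>, of "-1"] by linarith
  qed
  with \<eta> show ?thesis by (rule that)
qed

section \<open>The Gaussian field on the hypercube\<close>

text \<open>On the hypercube with N positive, this is the centred Gaussian field of unit variance
  whose covariance is the overlap \<open>scalar_prod N \<sigma> \<tau> / real N\<close>.\<close>

definition gauss_field :: "nat \<Rightarrow> (nat \<Rightarrow> real) \<Rightarrow> (nat \<Rightarrow> real) \<Rightarrow> real" where
  "gauss_field N g \<sigma> = scalar_prod N g \<sigma> / sqrt (real N)"

lemma gauss_field_eq: "gauss_field N g \<sigma> = scalar_prod N g (\<lambda>i. \<sigma> i / sqrt (real N))"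
  by (simp add: gauss_field_def scalar_prod_def sum_divide_distrib)

lemma gauss_field_measurable [measurable]:
  "(\<lambda>g. gauss_field N g \<sigma>) \<in> borel_measurable (\<Pi>\<^sub>M i\<in>{..<N}. borel)"
  unfolding gauss_field_def by measurable

lemma sum_squares_hypercube:
  assumes "\<sigma> \<in> hypercube N" "N \<ge> 1"
  shows "(\<Sum>i<N. (\<sigma> i / sqrt (real N))\<^sup>2) = 1"
proof -
  have "(\<Sum>i<N. (\<sigma> i / sqrt (real N))\<^sup>2) = (\<Sum>i<N. 1 / real N)"
    using hypercube_nth[OF assms(1)] by (intro sum.cong) (auto simp: power_divide power2_eq_1_iff)
  then show ?thesis using assms by simp
qed

lemmas gauss_field_unit = std_gaussian_unit_linear[OF sum_squares_hypercube, folded gauss_field_eq]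

text \<open>The difference is a centred Gaussian of variance 2 - 2 \<epsilon> \<epsilon>' overlap /
  N, which is at least 2 \<eta>; its mean modulus is sqrt (2 / pi) times the standard deviation. As
  the signs are arbitrary, the overlap has to be bounded in absolute value.\<close>

lemma gauss_field_diff_abs:
  assumes \<sigma>: "\<sigma> \<in> hypercube N" and \<tau>: "\<tau> \<in> hypercube N" and N: "N \<ge> 1"
    and e: "\<epsilon>\<^sup>2 = 1" "\<epsilon>'\<^sup>2 = 1"
  shows "integrable (std_gaussian N) (\<lambda>g. \<bar>\<epsilon> * gauss_field N g \<sigma> - \<epsilon>' * gauss_field N g \<tau>\<bar>)"
    and "\<bar>scalar_prod N \<sigma> \<tau>\<bar> \<le> (1 - \<eta>) * real N \<Longrightarrow>
      2 * sqrt (\<eta> / pi) \<le> (\<integral>g. \<bar>\<epsilon> * gauss_field N g \<sigma> - \<epsilon>' * gauss_field N g \<tau>\<bar> \<partial>std_gaussian N)"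
proof -
  define v where "v i = (\<epsilon> * \<sigma> i - \<epsilon>' * \<tau> i) / sqrt (real N)" for i
  have eq: "\<epsilon> * gauss_field N g \<sigma> - \<epsilon>' * gauss_field N g \<tau> = scalar_prod N g v" for g
    by (simp add: gauss_field_def scalar_prod_def v_def sum_distrib_left sum_subtractf
        sum_divide_distrib[symmetric] right_diff_distrib diff_divide_distrib mult_ac)
  show "integrable (std_gaussian N) (\<lambda>g. \<bar>\<epsilon> * gauss_field N g \<sigma> - \<epsilon>' * gauss_field N g \<tau>\<bar>)"
    unfolding eq by (rule std_gaussian_abs_linear)
  assume ov: "\<bar>scalar_prod N \<sigma> \<tau>\<bar> \<le> (1 - \<eta>) * real N"
  have "(\<Sum>i<N. (v i)\<^sup>2) = (\<Sum>i<N. (2 - 2 * (\<epsilon> * \<epsilon>') * (\<sigma> i * \<tau> i)) / real N)"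
    using hypercube_nth[OF \<sigma>] hypercube_nth[OF \<tau>] e
    by (intro sum.cong refl) (force simp: v_def power_divide power2_diff power_mult_distrib power2_eq_1_iff)
  also have "\<dots> = 2 - 2 * (\<epsilon> * \<epsilon>') * scalar_prod N \<sigma> \<tau> / real N"
    using N by (simp add: sum_divide_distrib[symmetric] sum_subtractf scalar_prod_def sum_distrib_left diff_divide_distrib)
  finally have s: "(\<Sum>i<N. (v i)\<^sup>2) = 2 - 2 * (\<epsilon> * \<epsilon>') * scalar_prod N \<sigma> \<tau> / real N" .
  have "\<epsilon> * \<epsilon>' * scalar_prod N \<sigma> \<tau> \<le> \<bar>scalar_prod N \<sigma> \<tau>\<bar>"
    using e by (auto simp: power2_eq_1_iff)
  also note ov
  finally have "2 * \<eta> \<le> (\<Sum>i<N. (v i)\<^sup>2)"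
    unfolding s using N by (simp add: field_simps)
  then have "sqrt (2 * \<eta>) * sqrt (2 / pi) \<le> sqrt (\<Sum>i<N. (v i)\<^sup>2) * sqrt (2 / pi)"
    by (intro mult_right_mono real_sqrt_le_mono) auto
  also have "sqrt (2 * \<eta>) * sqrt (2 / pi) = 2 * sqrt (\<eta> / pi)"
    by (simp add: real_sqrt_mult[symmetric] real_sqrt_divide)
       (simp add: real_sqrt_mult)
  finally show "2 * sqrt (\<eta> / pi) \<le> (\<integral>g. \<bar>\<epsilon> * gauss_field N g \<sigma> - \<epsilon>' * gauss_field N g \<tau>\<bar> \<partial>std_gaussian N)"
    unfolding eq std_gaussian_abs_linear .
qed

text \<open>Uses (a + b)^2 <= 2 a^2 + 2 b^2. The value 1/9 is the largest \<open>p\<close> with 2 p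
  / (1 - p) <= 1/4, and it also gives 2 / (1 - p) <= 9/4. The right side serves both as integrable
  majorant and as the estimate for bounded potential.\<close>

lemma exp_square_shift_crude:
  fixes x y p :: real
  assumes p: "0 \<le> p" "p \<le> 1/9"
  shows "exp ((y + sqrt p * x)\<^sup>2 / (1 - p)) \<le> exp (9/4 * y\<^sup>2) * exp (x\<^sup>2 / 4)"
proof -
  have "(y + sqrt p * x)\<^sup>2 \<le> 2 * y\<^sup>2 + 2 * (sqrt p * x)\<^sup>2"
    using zero_le_power2[of "y - sqrt p * x"] by (simp add: power2_sum power2_diff)
  also have "\<dots> = 2 * y\<^sup>2 + 2 * p * x\<^sup>2" using p by (simp add: power_mult_distrib)
  also have "2 * y\<^sup>2 \<le> (1 - p) * (9/4 * y\<^sup>2)"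
    using mult_right_mono[of 2 "(1 - p) * (9/4)" "y\<^sup>2"] p by (simp only: mult.assoc) simp
  also have "2 * p * x\<^sup>2 \<le> (1 - p) * (x\<^sup>2 / 4)"
    using mult_right_mono[of "2 * p" "(1 - p) / 4" "x\<^sup>2"] p by (simp add: mult_ac)
  finally have "(y + sqrt p * x)\<^sup>2 / (1 - p) \<le> 9/4 * y\<^sup>2 + x\<^sup>2 / 4"
    using p by (simp add: pos_divide_le_eq algebra_simps)
  then show ?thesis by (simp add: exp_add[symmetric])
qed

lemma exp_square_shift_integrable:
  assumes "\<sigma> \<in> hypercube N" "N \<ge> 1" "0 \<le> p" "p \<le> 1/9"
  shows "integrable (std_gaussian N) (\<lambda>g. exp ((y + sqrt p * gauss_field N g \<sigma>)\<^sup>2 / (1 - p)))"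
    and "(\<integral>g. exp ((y + sqrt p * gauss_field N g \<sigma>)\<^sup>2 / (1 - p)) \<partial>std_gaussian N) \<le> sqrt 2 * exp (9/4 * y\<^sup>2)"
proof -
  let ?f = "\<lambda>g. exp ((y + sqrt p * gauss_field N g \<sigma>)\<^sup>2 / (1 - p))"
  have i: "integrable (std_gaussian N) (\<lambda>g. exp (9/4 * y\<^sup>2) * exp ((gauss_field N g \<sigma>)\<^sup>2 / 4))"
    using gauss_field_unit(3)[OF assms(1,2)] by simp
  show int: "integrable (std_gaussian N) ?f"
    by (rule Bochner_Integration.integrable_bound[OF i])
       (use exp_square_shift_crude[OF assms(3,4)] in \<open>auto intro!: AE_I2\<close>)
  have "(\<integral>g. ?f g \<partial>std_gaussian N) \<le> (\<integral>g. exp (9/4 * y\<^sup>2) * exp ((gauss_field N g \<sigma>)\<^sup>2 / 4) \<partial>std_gaussian N)"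
    by (intro integral_mono int i exp_square_shift_crude assms)
  also have "\<dots> = sqrt 2 * exp (9/4 * y\<^sup>2)"
    using gauss_field_unit(4)[OF assms(1,2)] by simp
  finally show "(\<integral>g. ?f g \<partial>std_gaussian N) \<le> sqrt 2 * exp (9/4 * y\<^sup>2)" .
qed

lemma min_exp_square_shift_integrable:
  assumes "\<sigma> \<in> hypercube N" "\<tau> \<in> hypercube N" "N \<ge> 1" "0 \<le> p" "p \<le> 1/9"
  shows "integrable (std_gaussian N) (\<lambda>g. min (exp ((y + sqrt p * gauss_field N g \<sigma>)\<^sup>2 / (1 - p)))
      (exp ((y' + sqrt p * gauss_field N g \<tau>)\<^sup>2 / (1 - p))))"
  by (intro integrable_min exp_square_shift_integrable assms)

text \<open>The gain is linear in \<open>l\<close> and the error quadratic, so a small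
  \<open>l\<close> gives a true decrease whenever the mean difference stays away from zero.\<close>

lemma min_exp_square_shift_expectation:
  assumes \<sigma>: "\<sigma> \<in> hypercube N" and \<tau>: "\<tau> \<in> hypercube N" and N: "N \<ge> 1"
    and y: "\<bar>y\<bar> \<le> z" "\<bar>y'\<bar> \<le> z" and l: "0 < l" "l \<le> 1/32" and z: "z \<ge> 1 / l"
    and s: "\<epsilon> * y = \<bar>y\<bar>" "\<epsilon>\<^sup>2 = 1" and s': "\<epsilon>' * y' = \<bar>y'\<bar>" "\<epsilon>'\<^sup>2 = 1"
    and p: "p = (l / z)\<^sup>2"
  shows "(\<integral>g. min (exp ((y + sqrt p * gauss_field N g \<sigma>)\<^sup>2 / (1 - p)))
      (exp ((y' + sqrt p * gauss_field N g \<tau>)\<^sup>2 / (1 - p))) \<partial>std_gaussian N)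
    \<le> exp (z\<^sup>2) * (1 + 1740 * l\<^sup>2 - l * (\<integral>g. \<bar>\<epsilon> * gauss_field N g \<sigma> - \<epsilon>' * gauss_field N g \<tau>\<bar> \<partial>std_gaussian N))"
    (is "?I \<le> exp (z\<^sup>2) * (1 + _ - l * ?D)")
proof -
  interpret G: prob_space "std_gaussian N" by (rule prob_space_std_gaussian)
  let ?x = "\<lambda>g. gauss_field N g \<sigma>" and ?x' = "\<lambda>g. gauss_field N g \<tau>"
  have z0: "z > 0" using l z by (smt (verit) divide_pos_pos)
  have l1: "l\<^sup>2 \<le> 1/1024" using l power_mono[of l "1/32" 2] by (simp add: power_divide)
  have p_le: "p \<le> 1/9"
  proof -
    have "1 / l \<ge> 32" using l by (simp add: field_simps)
    then have "l / z \<le> (1/32) / 32" using z l by (intro frac_le) auto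
    then have "l / z \<le> 1/3" by simp
    then have "(l / z)\<^sup>2 \<le> (1/3)\<^sup>2" using l z0 by (intro power_mono) auto
    then show ?thesis by (simp add: p power2_eq_square)
  qed
  have p0: "p \<ge> 0" by (simp add: p)
  define D where "D = ?D"
  have D0: "D \<ge> 0" unfolding D_def by simp
  note ii = gauss_field_unit[OF \<sigma> N] gauss_field_unit[OF \<tau> N] gauss_field_diff_abs(1)[OF \<sigma> \<tau> N s(2) s'(2)]
  define r where "r = l / (1 - p)"
  have r: "l \<le> r" unfolding r_def using p_le p0 l by (simp add: pos_le_divide_eq mult_left_le)
  let ?b = "\<lambda>g. exp (z\<^sup>2) * (exp (2 * l\<^sup>2) * (1 + r * (\<epsilon> * ?x g + \<epsilon>' * ?x' g) - r * \<bar>\<epsilon> * ?x g - \<epsilon>' * ?x' g\<bar>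
       + 576 * l\<^sup>2 * (exp ((?x g)\<^sup>2 / 4) + exp ((?x' g)\<^sup>2 / 4))))"
  have ib: "integrable (std_gaussian N) ?b" using ii by simp
  have "?I \<le> (\<integral>g. ?b g \<partial>std_gaussian N)"
    using min_exp_square_shift_le[OF y l z s s']
    by (intro integral_mono ib min_exp_square_shift_integrable \<sigma> \<tau> N p0 p_le) (simp add: p r_def)
  \<comment> \<open>The linear terms have mean zero, and the two exponentials have mean sqrt 2 each:
    2 * 576 = 1152.\<close>
  also have "\<dots> = exp (z\<^sup>2) * (exp (2 * l\<^sup>2) * (1 - r * D + 1152 * sqrt 2 * l\<^sup>2))"
    using ii by (simp add: D_def G.prob_space)
  also have "\<dots> \<le> exp (z\<^sup>2) * (1 + 1740 * l\<^sup>2 - l * D)"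
  proof (intro mult_left_mono)
    \<comment> \<open>1740 rounds up 4 + 1728 + 6912 / 1024, where 1728 = 1152 * 3/2 and the last
      term comes from l^2 <= 1/1024.\<close>
    have e: "exp (2 * l\<^sup>2) \<le> 1 + 4 * l\<^sup>2" "1 \<le> exp (2 * l\<^sup>2)"
      using exp_bound[of "2 * l\<^sup>2"] l1 mult_left_mono[of "2 * l\<^sup>2" 1 "2 * l\<^sup>2"] by (auto simp: power2_eq_square)
    have "sqrt 2 \<le> 3/2" by (rule real_le_lsqrt) (auto simp: power2_eq_square)
    then have "1152 * sqrt 2 * l\<^sup>2 \<le> 1728 * l\<^sup>2" by (intro mult_right_mono) auto
    then have "exp (2 * l\<^sup>2) * (1 + 1152 * sqrt 2 * l\<^sup>2) \<le> (1 + 4 * l\<^sup>2) * (1 + 1728 * l\<^sup>2)"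
      using e by (intro mult_mono) auto
    also have "\<dots> = 1 + 1732 * l\<^sup>2 + 6912 * (l\<^sup>2 * l\<^sup>2)" by (simp add: algebra_simps)
    also have "\<dots> \<le> 1 + 1740 * l\<^sup>2"
      using mult_left_mono[OF l1, of "l\<^sup>2"] zero_le_power2[of l] by linarith
    finally have 1: "exp (2 * l\<^sup>2) * (1 + 1152 * sqrt 2 * l\<^sup>2) \<le> 1 + 1740 * l\<^sup>2" .
    have "l * D \<le> exp (2 * l\<^sup>2) * (r * D)"
      using mult_mono[OF e(2) mult_right_mono[OF r D0]] l D0 by simp
    with 1 show "exp (2 * l\<^sup>2) * (1 - r * D + 1152 * sqrt 2 * l\<^sup>2) \<le> 1 + 1740 * l\<^sup>2 - l * D"
      by (simp add: algebra_simps)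
  qed auto
  finally show ?thesis by (simp only: D_def)
qed

section \<open>The recursive selection\<close>

lemma exists_sign: "\<exists>\<epsilon>::real. \<epsilon> * y = \<bar>y\<bar> \<and> \<epsilon>\<^sup>2 = 1"
  by (rule exI[of _ "if y \<ge> 0 then 1 else -1"]) auto

text \<open>With \<zeta> = sqrt (\<eta> / pi), the choice of \<open>l\<close> turns the error 1740
  l^2 into l \<zeta> / 2. Pairs of small overlap have mean difference at least 2 \<zeta> and
  contribute 1 - 3/2 l \<zeta>; the others, such as the diagonal, contribute at most 1 + l \<zeta> /
  2. They are at most a quarter of each row, so the average is at most 1 - l \<zeta>.\<close>

lemma sum_min_exp_square_shift_large:
  fixes y :: "(nat \<Rightarrow> real) \<Rightarrow> real"
  assumes S: "S \<subseteq> hypercube N" and N: "N \<ge> 1" and \<eta>: "0 < \<eta>" "\<eta> < 1"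
    and bad: "\<And>\<sigma>. \<sigma> \<in> S \<Longrightarrow> 4 * real (card {\<tau> \<in> S. \<bar>scalar_prod N \<sigma> \<tau>\<bar> > (1 - \<eta>) * real N}) \<le> real (card S)"
    and l: "l = sqrt (\<eta> / pi) / 3480" and z: "z \<ge> 1 / l" and p: "p = (l / z)\<^sup>2"
    and y: "\<And>\<sigma>. \<sigma> \<in> S \<Longrightarrow> \<bar>y \<sigma>\<bar> \<le> z"
  shows "(\<Sum>\<sigma>\<in>S. \<Sum>\<tau>\<in>S. \<integral>g. min (exp ((y \<sigma> + sqrt p * gauss_field N g \<sigma>)\<^sup>2 / (1 - p)))
      (exp ((y \<tau> + sqrt p * gauss_field N g \<tau>)\<^sup>2 / (1 - p))) \<partial>std_gaussian N)
    \<le> exp (z\<^sup>2) * (1 - l * sqrt (\<eta> / pi)) * (real (card S))\<^sup>2"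
proof -
  define \<zeta> where "\<zeta> = sqrt (\<eta> / pi)"
  define I where "I \<sigma> \<tau> = (\<integral>g. min (exp ((y \<sigma> + sqrt p * gauss_field N g \<sigma>)\<^sup>2 / (1 - p)))
      (exp ((y \<tau> + sqrt p * gauss_field N g \<tau>)\<^sup>2 / (1 - p))) \<partial>std_gaussian N)" for \<sigma> \<tau>
  have fin: "finite S" using S finite_hypercube finite_subset by blast
  have \<zeta>: "0 < \<zeta>" "\<zeta> \<le> 1"
    using \<eta> pi_gt3 by (auto simp: \<zeta>_def)
  have l0: "0 < l" "l \<le> 1/32" using \<zeta> by (auto simp: l \<zeta>_def[symmetric])
  have l2: "1740 * l\<^sup>2 = l * \<zeta> / 2" by (simp add: l \<zeta>_def[symmetric] power2_eq_square)
  have I: "I \<sigma> \<tau> \<le> exp (z\<^sup>2) * (1 + l * \<zeta> / 2)"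
    and I_good: "\<bar>scalar_prod N \<sigma> \<tau>\<bar> \<le> (1 - \<eta>) * real N \<Longrightarrow> I \<sigma> \<tau> \<le> exp (z\<^sup>2) * (1 - 3/2 * (l * \<zeta>))"
    if st: "\<sigma> \<in> S" "\<tau> \<in> S" for \<sigma> \<tau>
  proof -
    obtain e e' :: real where e: "e * y \<sigma> = \<bar>y \<sigma>\<bar>" "e\<^sup>2 = 1" and e': "e' * y \<tau> = \<bar>y \<tau>\<bar>" "e'\<^sup>2 = 1"
      using exists_sign by metis
    have cube: "\<sigma> \<in> hypercube N" "\<tau> \<in> hypercube N" using st S by auto
    let ?D = "\<integral>g. \<bar>e * gauss_field N g \<sigma> - e' * gauss_field N g \<tau>\<bar> \<partial>std_gaussian N"
    have b: "I \<sigma> \<tau> \<le> exp (z\<^sup>2) * (1 + l * \<zeta> / 2 - l * ?D)"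
      using min_exp_square_shift_expectation[OF cube N y[OF st(1)] y[OF st(2)] l0 z e e' p]
      unfolding I_def l2 .
    have "0 \<le> ?D" by simp
    then have "exp (z\<^sup>2) * (1 + l * \<zeta> / 2 - l * ?D) \<le> exp (z\<^sup>2) * (1 + l * \<zeta> / 2)"
      using l0 by (intro mult_left_mono) auto
    with b show "I \<sigma> \<tau> \<le> exp (z\<^sup>2) * (1 + l * \<zeta> / 2)" by linarith
    assume "\<bar>scalar_prod N \<sigma> \<tau>\<bar> \<le> (1 - \<eta>) * real N"
    then have "2 * \<zeta> \<le> ?D"
      unfolding \<zeta>_def by (rule gauss_field_diff_abs(2)[OF cube N e(2) e'(2)])
    then have "l * (2 * \<zeta>) \<le> l * ?D" using l0 by (intro mult_left_mono) auto
    then have "exp (z\<^sup>2) * (1 + l * \<zeta> / 2 - l * ?D) \<le> exp (z\<^sup>2) * (1 - 3/2 * (l * \<zeta>))"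
      by (intro mult_left_mono) auto
    with b show "I \<sigma> \<tau> \<le> exp (z\<^sup>2) * (1 - 3/2 * (l * \<zeta>))" by linarith
  qed
  have row: "(\<Sum>\<tau>\<in>S. I \<sigma> \<tau>) \<le> exp (z\<^sup>2) * (1 - l * \<zeta>) * real (card S)" if \<sigma>: "\<sigma> \<in> S" for \<sigma>
  proof -
    define P where "P \<tau> \<longleftrightarrow> \<bar>scalar_prod N \<sigma> \<tau>\<bar> > (1 - \<eta>) * real N" for \<tau>
    have "(\<Sum>\<tau>\<in>S. I \<sigma> \<tau>) \<le> (\<Sum>\<tau>\<in>S. exp (z\<^sup>2) * (1 - 3/2 * (l * \<zeta>)) +
        (if P \<tau> then exp (z\<^sup>2) * (2 * (l * \<zeta>)) else 0))"
    proof (rule sum_mono)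
      fix \<tau> assume \<tau>: "\<tau> \<in> S"
      show "I \<sigma> \<tau> \<le> exp (z\<^sup>2) * (1 - 3/2 * (l * \<zeta>)) + (if P \<tau> then exp (z\<^sup>2) * (2 * (l * \<zeta>)) else 0)"
        using I[OF \<sigma> \<tau>] I_good[OF \<sigma> \<tau>] \<tau> by (auto simp: P_def algebra_simps not_less)
    qed
    also have "\<dots> = exp (z\<^sup>2) * ((1 - 3/2 * (l * \<zeta>)) * card S + l * \<zeta> / 2 * (4 * card {\<tau> \<in> S. P \<tau>}))"
      using fin by (simp add: sum.distrib sum.inter_filter[symmetric]) (simp add: algebra_simps)
    also have "\<dots> \<le> exp (z\<^sup>2) * ((1 - 3/2 * (l * \<zeta>)) * card S + l * \<zeta> / 2 * card S)"
      using bad[OF \<sigma>, folded P_def] l0 \<zeta> by (intro mult_left_mono add_left_mono) auto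
    also have "\<dots> = exp (z\<^sup>2) * (1 - l * \<zeta>) * real (card S)" by (simp add: algebra_simps)
    finally show ?thesis .
  qed
  have "(\<Sum>\<sigma>\<in>S. \<Sum>\<tau>\<in>S. I \<sigma> \<tau>) \<le> (\<Sum>\<sigma>\<in>S. exp (z\<^sup>2) * (1 - l * \<zeta>) * real (card S))"
    by (intro sum_mono row)
  then show ?thesis unfolding I_def \<zeta>_def by (simp add: power2_eq_square mult_ac)
qed

text \<open>Regime of bounded potential: no drift is sought, and the potential may grow by a
  constant that the decrease of the remaining variance will pay for.\<close>

lemma sum_min_exp_square_shift_small:
  fixes y :: "(nat \<Rightarrow> real) \<Rightarrow> real"
  assumes S: "S \<subseteq> hypercube N" and N: "N \<ge> 1" and p: "0 \<le> p" "p \<le> 1/9"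
    and y: "\<And>\<sigma>. \<sigma> \<in> S \<Longrightarrow> (y \<sigma>)\<^sup>2 \<le> w"
  shows "(\<Sum>\<sigma>\<in>S. \<Sum>\<tau>\<in>S. \<integral>g. min (exp ((y \<sigma> + sqrt p * gauss_field N g \<sigma>)\<^sup>2 / (1 - p)))
      (exp ((y \<tau> + sqrt p * gauss_field N g \<tau>)\<^sup>2 / (1 - p))) \<partial>std_gaussian N)
    \<le> sqrt 2 * exp (9/4 * w) * (real (card S))\<^sup>2"
proof -
  have "(\<Sum>\<sigma>\<in>S. \<Sum>\<tau>\<in>S. \<integral>g. min (exp ((y \<sigma> + sqrt p * gauss_field N g \<sigma>)\<^sup>2 / (1 - p)))
      (exp ((y \<tau> + sqrt p * gauss_field N g \<tau>)\<^sup>2 / (1 - p))) \<partial>std_gaussian N)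
     \<le> (\<Sum>\<sigma>\<in>S. \<Sum>\<tau>\<in>S. sqrt 2 * exp (9/4 * w))"
  proof (intro sum_mono)
    fix \<sigma> \<tau> assume st: "\<sigma> \<in> S" "\<tau> \<in> S"
    then have cube: "\<sigma> \<in> hypercube N" "\<tau> \<in> hypercube N" using S by auto
    have "(\<integral>g. min (exp ((y \<sigma> + sqrt p * gauss_field N g \<sigma>)\<^sup>2 / (1 - p)))
        (exp ((y \<tau> + sqrt p * gauss_field N g \<tau>)\<^sup>2 / (1 - p))) \<partial>std_gaussian N)
      \<le> (\<integral>g. exp ((y \<sigma> + sqrt p * gauss_field N g \<sigma>)\<^sup>2 / (1 - p)) \<partial>std_gaussian N)"
      by (intro integral_mono min_exp_square_shift_integrable exp_square_shift_integrable cube N p) simp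
    also have "\<dots> \<le> sqrt 2 * exp (9/4 * (y \<sigma>)\<^sup>2)"
      by (rule exp_square_shift_integrable[OF cube(1) N p])
    also have "\<dots> \<le> sqrt 2 * exp (9/4 * w)"
      using y[OF st(1)] by (intro mult_left_mono) auto
    finally show "(\<integral>g. min (exp ((y \<sigma> + sqrt p * gauss_field N g \<sigma>)\<^sup>2 / (1 - p)))
        (exp ((y \<tau> + sqrt p * gauss_field N g \<tau>)\<^sup>2 / (1 - p))) \<partial>std_gaussian N) \<le> sqrt 2 * exp (9/4 * w)" .
  qed
  also have "\<dots> = sqrt 2 * exp (9/4 * w) * (real (card S))\<^sup>2" by (simp add: power2_eq_square)
  finally show ?thesis .
qed

section \<open>The failure event and its recursion\<close>

text \<open>Here \<open>y \<sigma>\<close> is the part already revealed, measured from the middle of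
  the strip, and all lengths are in units in which the field still to come has variance 1. The
  threshold is a count, since \<open>S\<close> will shrink along the recursion.\<close>

definition sparse_event ::
    "nat \<Rightarrow> (nat \<Rightarrow> real) set \<Rightarrow> ((nat \<Rightarrow> real) \<Rightarrow> real) \<Rightarrow> real \<Rightarrow> real \<Rightarrow> (nat \<Rightarrow> real) set" where
  "sparse_event N S y r \<theta> =
    {g \<in> space (std_gaussian N). real (card {\<sigma> \<in> S. \<bar>y \<sigma> + gauss_field N g \<sigma>\<bar> \<le> r}) < \<theta>}"

lemma sparse_event_sets [measurable]:
  assumes "finite S"
  shows "sparse_event N S y r \<theta> \<in> sets (std_gaussian N)"
proof -
  have "real (card {\<sigma> \<in> S. \<bar>y \<sigma> + gauss_field N g \<sigma>\<bar> \<le> r})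
     = (\<Sum>\<sigma>\<in>S. if \<bar>y \<sigma> + gauss_field N g \<sigma>\<bar> \<le> r then 1 else 0)" for g
    using assms by (simp add: sum.If_cases Int_def)
  then show ?thesis unfolding sparse_event_def by simp measurable
qed

lemma sparse_event_mono:
  assumes "finite S" "S' \<subseteq> S" "\<theta> \<le> \<theta>'"
  shows "sparse_event N S y r \<theta> \<subseteq> sparse_event N S' y r \<theta>'"
proof
  fix g assume g: "g \<in> sparse_event N S y r \<theta>"
  have "card {\<sigma> \<in> S'. \<bar>y \<sigma> + gauss_field N g \<sigma>\<bar> \<le> r} \<le> card {\<sigma> \<in> S. \<bar>y \<sigma> + gauss_field N g \<sigma>\<bar> \<le> r}"
    using assms by (intro card_mono) auto
  then show "g \<in> sparse_event N S' y r \<theta>'" using g assms by (auto simp: sparse_event_def)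
qed

lemma gauss_field_combine:
  "gauss_field N (\<lambda>i\<in>{..<N}. a * g i + b * h i) \<sigma> = a * gauss_field N g \<sigma> + b * gauss_field N h \<sigma>"
  by (simp add: gauss_field_def scalar_prod_def sum_distrib_left sum.distrib add_divide_distrib distrib_right mult.assoc)

text \<open>
  Writes the field as \<open>sqrt p\<close> times a first copy plus \<open>sqrt (1 - p)\<close> times an independent one.
  After the first copy is revealed, only the points of a large sublevel set of the new potential
  are kept.
\<close>
lemma sparse_event_split:
  fixes y :: "(nat \<Rightarrow> real) \<Rightarrow> real" and c p r \<theta> A B :: real
  assumes S: "S \<subseteq> hypercube N" "S \<noteq> {}" and N: "N \<ge> 1" and p: "0 < p" "p \<le> 1/9" and c: "0 < c" "c < 1"
    and B: "0 \<le> B"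
    and IH: "\<And>S' y' Q'. S' \<subseteq> S \<Longrightarrow> c * card S \<le> card S' \<Longrightarrow> (\<And>\<sigma>. \<sigma> \<in> S' \<Longrightarrow> exp ((y' \<sigma>)\<^sup>2) \<le> Q') \<Longrightarrow>
       measure (std_gaussian N) (sparse_event N S' y' (r / sqrt (1 - p)) \<theta>) \<le> B * Q'"
    and A: "(\<Sum>\<sigma>\<in>S. \<Sum>\<tau>\<in>S. \<integral>g. min (exp ((y \<sigma> + sqrt p * gauss_field N g \<sigma>)\<^sup>2 / (1 - p)))
      (exp ((y \<tau> + sqrt p * gauss_field N g \<tau>)\<^sup>2 / (1 - p))) \<partial>std_gaussian N) \<le> A * (real (card S))\<^sup>2"
  shows "measure (std_gaussian N) (sparse_event N S y r \<theta>) \<le> B * (A / (1 - c)\<^sup>2)"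
proof -
  interpret G: prob_space "std_gaussian N" by (rule prob_space_std_gaussian)
  have fin: "finite S" using S finite_hypercube finite_subset by blast
  have cS: "card S > 0" using S fin by (simp add: card_gt_0_iff)
  have p1: "0 < 1 - p" using p by simp
  let ?G = "std_gaussian N"
  let ?F = "sparse_event N S y r \<theta>"
  define f where "f g \<sigma> = exp ((y \<sigma> + sqrt p * gauss_field N g \<sigma>)\<^sup>2 / (1 - p))" for g \<sigma>
  define q where "q g = (\<Sum>\<sigma>\<in>S. \<Sum>\<tau>\<in>S. min (f g \<sigma>) (f g \<tau>)) / ((1 - c)\<^sup>2 * (real (card S))\<^sup>2)" for g
  define comb where "comb = (\<lambda>(g :: nat \<Rightarrow> real, h :: nat \<Rightarrow> real). \<lambda>i\<in>{..<N}. sqrt p * g i + sqrt (1 - p) * h i)"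
  have comb [measurable]: "comb \<in> ?G \<Otimes>\<^sub>M ?G \<rightarrow>\<^sub>M ?G" unfolding comb_def by measurable
  have distr: "distr (?G \<Otimes>\<^sub>M ?G) ?G comb = ?G"
    unfolding comb_def using p by (intro std_gaussian_combine) auto
  have ii: "integrable ?G (\<lambda>g. min (f g \<sigma>) (f g \<tau>))" if "\<sigma> \<in> S" "\<tau> \<in> S" for \<sigma> \<tau>
    unfolding f_def using that S p by (intro min_exp_square_shift_integrable N) auto
  have iq: "integrable ?G q" unfolding q_def using ii by (intro integrable_divide_zero Bochner_Integration.integrable_sum) auto
  have q0: "q g \<ge> 0" for g
    unfolding q_def f_def by (intro divide_nonneg_nonneg sum_nonneg) auto
  \<comment> \<open>For fixed \<open>g\<close> the selected set is deterministic, so the induction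
    hypothesis applies to the section. Only the measurable bound \<open>q g\<close> is integrated
    afterwards, so no measurability of the selection enters.\<close>
  have sec: "emeasure ?G (Pair g -` (comb -` ?F \<inter> space (?G \<Otimes>\<^sub>M ?G))) \<le> ennreal (B * q g)"
    if g: "g \<in> space ?G" for g
  proof -
    define S' where "S' = {\<sigma> \<in> S. f g \<sigma> \<le> q g}"
    \<comment> \<open>Division by sqrt (1 - p) restores unit variance for what is left, and turns
      the half-width \<open>r\<close> into \<open>r / sqrt (1 - p)\<close>.\<close>
    define y' where "y' \<sigma> = (y \<sigma> + sqrt p * gauss_field N g \<sigma>) / sqrt (1 - p)" for \<sigma>
    have S'_sub: "S' \<subseteq> S" by (auto simp: S'_def)
    have "Pair g -` (comb -` ?F \<inter> space (?G \<Otimes>\<^sub>M ?G)) \<subseteq> sparse_event N S y' (r / sqrt (1 - p)) \<theta>"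
    proof
      fix h assume h: "h \<in> Pair g -` (comb -` ?F \<inter> space (?G \<Otimes>\<^sub>M ?G))"
      have "\<bar>y \<sigma> + gauss_field N (comb (g, h)) \<sigma>\<bar> \<le> r \<longleftrightarrow> \<bar>y' \<sigma> + gauss_field N h \<sigma>\<bar> \<le> r / sqrt (1 - p)" for \<sigma>
      proof -
        have "y \<sigma> + gauss_field N (comb (g, h)) \<sigma> = sqrt (1 - p) * (y' \<sigma> + gauss_field N h \<sigma>)"
        proof -
          have "sqrt (1 - p) * y' \<sigma> = y \<sigma> + sqrt p * gauss_field N g \<sigma>" using p1 by (simp add: y'_def)
          then show ?thesis by (simp add: comb_def gauss_field_combine distrib_left)
        qed
        then show ?thesis using p1 by (simp add: abs_mult pos_le_divide_eq mult.commute)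
      qed
      then show "h \<in> sparse_event N S y' (r / sqrt (1 - p)) \<theta>"
        using h g by (simp add: sparse_event_def space_pair_measure)
    qed
    also have "\<dots> \<subseteq> sparse_event N S' y' (r / sqrt (1 - p)) \<theta>"
      by (intro sparse_event_mono fin S'_sub order_refl)
    finally have sub: "Pair g -` (comb -` ?F \<inter> space (?G \<Otimes>\<^sub>M ?G)) \<subseteq> sparse_event N S' y' (r / sqrt (1 - p)) \<theta>" .
    have "measure ?G (sparse_event N S' y' (r / sqrt (1 - p)) \<theta>) \<le> B * q g"
    proof (rule IH[OF S'_sub])
      show "c * card S \<le> card S'"
        unfolding S'_def q_def by (rule exists_large_sublevel) (use fin S c in \<open>auto simp: f_def\<close>)
      show "exp ((y' \<sigma>)\<^sup>2) \<le> q g" if "\<sigma> \<in> S'" for \<sigma>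
        using that p1 by (simp add: S'_def f_def y'_def power_divide)
    qed
    then have "emeasure ?G (sparse_event N S' y' (r / sqrt (1 - p)) \<theta>) \<le> ennreal (B * q g)"
      by (simp add: G.emeasure_eq_measure ennreal_leI)
    moreover have "emeasure ?G (Pair g -` (comb -` ?F \<inter> space (?G \<Otimes>\<^sub>M ?G)))
        \<le> emeasure ?G (sparse_event N S' y' (r / sqrt (1 - p)) \<theta>)"
      using sub S'_sub fin by (intro emeasure_mono sparse_event_sets) (auto intro: finite_subset)
    ultimately show ?thesis by simp
  qed
  have "emeasure ?G ?F = emeasure (distr (?G \<Otimes>\<^sub>M ?G) ?G comb) ?F" by (simp add: distr)
  also have "\<dots> = emeasure (?G \<Otimes>\<^sub>M ?G) (comb -` ?F \<inter> space (?G \<Otimes>\<^sub>M ?G))"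
    using fin by (intro emeasure_distr comb sparse_event_sets)
  also have "\<dots> = (\<integral>\<^sup>+g. emeasure ?G (Pair g -` (comb -` ?F \<inter> space (?G \<Otimes>\<^sub>M ?G))) \<partial>?G)"
    using fin by (intro G.emeasure_pair_measure_alt measurable_sets[OF comb] sparse_event_sets)
  also have "\<dots> \<le> (\<integral>\<^sup>+g. ennreal (B * q g) \<partial>?G)" by (intro nn_integral_mono sec)
  also have "\<dots> = ennreal (\<integral>g. B * q g \<partial>?G)"
    using iq B q0 by (intro nn_integral_eq_integral) auto
  finally have "measure ?G ?F \<le> (\<integral>g. B * q g \<partial>?G)"
    using B q0 by (simp add: G.emeasure_eq_measure integral_nonneg)
  also have "\<dots> = B * (\<integral>g. q g \<partial>?G)" by simp
  also have "\<dots> \<le> B * (A / (1 - c)\<^sup>2)"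
  proof (intro mult_left_mono B)
    have "(\<integral>g. q g \<partial>?G) = (\<Sum>\<sigma>\<in>S. \<Sum>\<tau>\<in>S. \<integral>g. min (f g \<sigma>) (f g \<tau>) \<partial>?G) / ((1 - c)\<^sup>2 * (real (card S))\<^sup>2)"
      unfolding q_def using ii by (simp add: Bochner_Integration.integral_sum Bochner_Integration.integrable_sum)
    also have "\<dots> \<le> A * (real (card S))\<^sup>2 / ((1 - c)\<^sup>2 * (real (card S))\<^sup>2)"
      using A unfolding f_def by (intro divide_right_mono) auto
    also have "\<dots> = A / (1 - c)\<^sup>2" using cS by simp
    finally show "(\<integral>g. q g \<partial>?G) \<le> A / (1 - c)\<^sup>2" .
  qed
  finally show ?thesis .
qed

text \<open>Markov's inequality for the number of points outside the strip. Outside, r^2 <= 2 y^2 +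
  2 x^2 with x the field, so exp (y^2 / 4 + x^2 / 4 - r^2 / 8) majorises the indicator.\<close>

lemma sparse_event_base:
  fixes y :: "(nat \<Rightarrow> real) \<Rightarrow> real"
  assumes S: "S \<subseteq> hypercube N" "S \<noteq> {}" and N: "N \<ge> 1" and r: "r > 0"
    and y: "\<And>\<sigma>. \<sigma> \<in> S \<Longrightarrow> exp ((y \<sigma>)\<^sup>2) \<le> Q"
  shows "measure (std_gaussian N) (sparse_event N S y r (card S / 2)) \<le> 4 * exp (- r\<^sup>2 / 8) * Q"
proof -
  interpret G: prob_space "std_gaussian N" by (rule prob_space_std_gaussian)
  let ?G = "std_gaussian N"
  have fin: "finite S" using S finite_hypercube finite_subset by blast
  have cS: "real (card S) > 0" using S fin by (simp add: card_gt_0_iff)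
  define w where "w g = (\<Sum>\<sigma>\<in>S. exp (- r\<^sup>2 / 8) * (exp ((y \<sigma>)\<^sup>2 / 4) * exp ((gauss_field N g \<sigma>)\<^sup>2 / 4)))" for g
  have iw: "integrable ?G w" unfolding w_def
    using S by (intro Bochner_Integration.integrable_sum integrable_mult_right gauss_field_unit(3) N) auto
  have w0: "w g \<ge> 0" for g unfolding w_def by (intro sum_nonneg) auto
  have outside: "1 \<le> exp (- r\<^sup>2 / 8) * (exp ((y \<sigma>)\<^sup>2 / 4) * exp ((gauss_field N g \<sigma>)\<^sup>2 / 4))"
    if "\<not> \<bar>y \<sigma> + gauss_field N g \<sigma>\<bar> \<le> r" for g \<sigma>
  proof -
    have "r\<^sup>2 \<le> (y \<sigma> + gauss_field N g \<sigma>)\<^sup>2"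
      using that r by (metis abs_le_square_iff abs_of_pos linear not_le)
    also have "\<dots> \<le> 2 * (y \<sigma>)\<^sup>2 + 2 * (gauss_field N g \<sigma>)\<^sup>2"
      using zero_le_power2[of "y \<sigma> - gauss_field N g \<sigma>"] by (simp add: power2_sum power2_diff)
    finally show ?thesis by (simp add: exp_add[symmetric])
  qed
  have "sparse_event N S y r (card S / 2) \<subseteq> {g \<in> space ?G. card S / 2 \<le> w g}"
  proof
    fix g assume g: "g \<in> sparse_event N S y r (card S / 2)"
    let ?U = "{\<sigma> \<in> S. \<not> \<bar>y \<sigma> + gauss_field N g \<sigma>\<bar> \<le> r}"
    have "card S = card {\<sigma> \<in> S. \<bar>y \<sigma> + gauss_field N g \<sigma>\<bar> \<le> r} + card ?U"
      using fin by (subst card_Un_disjoint[symmetric]) (auto intro!: arg_cong[where f = card])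
    then have "card S / 2 \<le> card ?U" using g by (simp add: sparse_event_def)
    also have "real (card ?U) = (\<Sum>\<sigma>\<in>?U. 1)" by simp
    also have "\<dots> \<le> (\<Sum>\<sigma>\<in>?U. exp (- r\<^sup>2 / 8) * (exp ((y \<sigma>)\<^sup>2 / 4) * exp ((gauss_field N g \<sigma>)\<^sup>2 / 4)))"
      by (intro sum_mono outside) auto
    also have "\<dots> \<le> w g" unfolding w_def using fin by (intro sum_mono2) auto
    finally show "g \<in> {g \<in> space ?G. card S / 2 \<le> w g}" using g by (simp add: sparse_event_def)
  qed
  then have "measure ?G (sparse_event N S y r (card S / 2)) \<le> measure ?G {g \<in> space ?G. card S / 2 \<le> w g}"
    using iw by (intro G.finite_measure_mono) auto
  also have "\<dots> \<le> (\<integral>g. w g \<partial>?G) / (card S / 2)"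
    using iw w0 cS by (intro integral_Markov_inequality_measure[where A = "space ?G"]) auto
  also have "(\<integral>g. w g \<partial>?G) = (\<Sum>\<sigma>\<in>S. exp (- r\<^sup>2 / 8) * (exp ((y \<sigma>)\<^sup>2 / 4) * sqrt 2))"
    unfolding w_def using S gauss_field_unit(3,4)[OF _ N]
    by (subst Bochner_Integration.integral_sum) (auto intro!: sum.cong)
  also have "\<dots> \<le> (\<Sum>\<sigma>\<in>S. exp (- r\<^sup>2 / 8) * (Q * 2))"
  proof (intro sum_mono mult_left_mono mult_mono)
    fix \<sigma> assume "\<sigma> \<in> S"
    have "exp ((y \<sigma>)\<^sup>2 / 4) \<le> exp ((y \<sigma>)\<^sup>2)" by simp
    also have "\<dots> \<le> Q" using \<open>\<sigma> \<in> S\<close> by (rule y)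
    finally show "exp ((y \<sigma>)\<^sup>2 / 4) \<le> Q" .
    show "sqrt 2 \<le> 2" by (rule real_le_lsqrt) auto
    show "0 \<le> Q" using y[OF \<open>\<sigma> \<in> S\<close>] by (meson exp_ge_zero order_trans)
  qed auto
  finally show ?thesis using cS by (simp add: divide_right_mono field_simps)
qed

text \<open>A single term of the exponential series. It converts the final Gaussian tail in
  \<open>r\<close> into the power of \<open>r\<close> that the recursion carries along.\<close>

lemma power_le_fact_exp:
  fixes x :: real
  assumes "0 \<le> x"
  shows "x ^ k \<le> fact k * exp x"
proof -
  have "(\<Sum>n\<in>{k}. x ^ n /\<^sub>R fact n) \<le> (\<Sum>n. x ^ n /\<^sub>R fact n)"
    using assms by (intro sum_le_suminf summable_exp_generic) auto
  then have "x ^ k / fact k \<le> exp x" by (simp add: exp_def divide_inverse_commute)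
  then show ?thesis by (simp add: field_simps)
qed

text \<open>Induction on the number of steps. Since \<open>r\<close> is a fixed width over sqrt T,
  the factor 1 / (r^2)^k is the T^k of the potential up to a constant, and revealing a proportion
  \<open>p\<close> of the variance multiplies it by (1 - p)^k. \<open>M\<close> is a size above
  which pairs of large overlap are rare; the assumption on \<open>n\<close> keeps every intermediate
  set above it.\<close>

lemma sparse_event_bound:
  fixes \<eta> M :: real and k :: nat
  assumes \<eta>: "0 < \<eta>" "\<eta> < 1" and l: "l = sqrt (\<eta> / pi) / 3480" and \<gamma>: "\<gamma> = l * sqrt (\<eta> / pi)"
    and k: "sqrt 2 * exp (9/4 * (1 / l\<^sup>2)) * (9/10) ^ k \<le> 1 - \<gamma>"
    and N: "N \<ge> 1" and M: "0 < M"
    and bad: "\<And>S \<sigma>. S \<subseteq> hypercube N \<Longrightarrow> M \<le> real (card S) \<Longrightarrow> \<sigma> \<in> S \<Longrightarrow>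
      4 * real (card {\<tau> \<in> S. \<bar>scalar_prod N \<sigma> \<tau>\<bar> > (1 - \<eta>) * real N}) \<le> real (card S)"
    and S: "S \<subseteq> hypercube N" "M \<le> (\<gamma> / 4) ^ n * real (card S)"
    and y: "\<And>\<sigma>. \<sigma> \<in> S \<Longrightarrow> exp ((y \<sigma>)\<^sup>2) \<le> Q" and r: "r > 0"
  shows "measure (std_gaussian N) (sparse_event N S y r ((\<gamma> / 4) ^ n * real (card S) / 2))
    \<le> 4 * 8 ^ k * fact k * (1 - \<gamma> / 2) ^ n * Q / (r\<^sup>2) ^ k"
  using S y r
proof (induction n arbitrary: S y Q r)
  case 0
  have S: "S \<noteq> {}" using 0 M by auto
  have fin: "finite S" using 0 finite_hypercube finite_subset by blast
  obtain \<sigma> where "\<sigma> \<in> S" using S by auto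
  then have Q: "0 \<le> Q" using 0(3)[of \<sigma>] by (smt (verit) exp_gt_zero)
  have "measure (std_gaussian N) (sparse_event N S y r (card S / 2)) \<le> 4 * exp (- r\<^sup>2 / 8) * Q"
    by (rule sparse_event_base) (use 0 S N in auto)
  also have "\<dots> \<le> 4 * (8 ^ k * fact k / (r\<^sup>2) ^ k) * Q"
  proof (intro mult_right_mono mult_left_mono Q)
    have "(r\<^sup>2 / 8) ^ k \<le> fact k * exp (r\<^sup>2 / 8)" by (rule power_le_fact_exp) simp
    then show "exp (- r\<^sup>2 / 8) \<le> 8 ^ k * fact k / (r\<^sup>2) ^ k"
      using 0(4) by (simp add: power_divide exp_minus field_simps)
  qed simp
  finally show ?case by simp
next
  case (Suc n)
  define c where "c = \<gamma> / 4"
  define \<rho> where "\<rho> = 1 - \<gamma> / 2"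
  define B where "B = 4 * 8 ^ k * (fact k :: real)"
  have z0: "0 < sqrt (\<eta> / pi)" "sqrt (\<eta> / pi) \<le> 1" using \<eta> pi_gt3 by auto
  have l0: "0 < l" "l \<le> 1/3480" using z0 by (auto simp: l)
  have g: "0 < \<gamma>" "\<gamma> \<le> 1/3480"
    using mult_mono[OF l0(2) z0(2)] z0 l0 by (auto simp: \<gamma>)
  have c: "0 < c" "c < 1" and \<rho>: "0 < \<rho>" using g by (auto simp: c_def \<rho>_def)
  \<comment> \<open>Passing from the mean of a pairwise minimum to a sublevel set costs 1 / (1 -
    c)^2. Half of the gain \<gamma> survives, because 1 - \<gamma> <= \<rho>^2 and (1 - c)^2 >=
    \<rho>.\<close>
  have c\<rho>: "(1 - \<gamma>) / (1 - c)\<^sup>2 \<le> \<rho>"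
  proof -
    have "1 - \<gamma> \<le> \<rho> * \<rho>" by (simp add: \<rho>_def algebra_simps)
    also have "\<dots> \<le> \<rho> * (1 - c)\<^sup>2"
      using \<rho> by (intro mult_left_mono) (simp_all add: c_def \<rho>_def power2_eq_square algebra_simps)
    finally show ?thesis using c by (simp add: pos_divide_le_eq)
  qed
  have M': "M \<le> c * (c ^ n * card S)" using Suc.prems(2) by (simp add: c_def)
  have S: "S \<noteq> {}" using M' M by auto
  have cS: "M \<le> card S"
  proof -
    have "c ^ Suc n * card S \<le> 1 * real (card S)" using c by (intro mult_right_mono power_le_one) auto
    then show ?thesis using M' by simp
  qed
  obtain \<sigma>0 where \<sigma>0: "\<sigma>0 \<in> S" using S by auto
  have Q1: "1 \<le> Q" using Suc.prems(3)[OF \<sigma>0] by (meson one_le_exp_iff order_trans zero_le_power2)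
  \<comment> \<open>Both regimes reduce to one requirement: the new potential, with the variance
    factor included, is at most 1 - \<gamma> times the old one.\<close>
  have step: "measure (std_gaussian N) (sparse_event N S y r (c ^ Suc n * card S / 2)) \<le> B * \<rho> ^ Suc n * Q / (r\<^sup>2) ^ k"
    if p: "0 < p" "p \<le> 1/9"
      and A: "(\<Sum>\<sigma>\<in>S. \<Sum>\<tau>\<in>S. \<integral>g. min (exp ((y \<sigma> + sqrt p * gauss_field N g \<sigma>)\<^sup>2 / (1 - p)))
        (exp ((y \<tau> + sqrt p * gauss_field N g \<tau>)\<^sup>2 / (1 - p))) \<partial>std_gaussian N) \<le> A * (real (card S))\<^sup>2"
      and AQ: "(1 - p) ^ k * A \<le> (1 - \<gamma>) * Q" for p A
  proof -
    let ?B = "B * \<rho> ^ n * (1 - p) ^ k / (r\<^sup>2) ^ k"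
    have B0: "0 \<le> ?B" using p \<rho> by (simp add: B_def)
    have "measure (std_gaussian N) (sparse_event N S y r (c ^ Suc n * card S / 2)) \<le> ?B * (A / (1 - c)\<^sup>2)"
    proof (rule sparse_event_split[OF Suc.prems(1) S N p c B0 _ A])
      fix S' :: "(nat \<Rightarrow> real) set" and y' :: "(nat \<Rightarrow> real) \<Rightarrow> real" and Q' :: real
      assume S': "S' \<subseteq> S" "c * card S \<le> card S'" and y': "\<And>\<sigma>. \<sigma> \<in> S' \<Longrightarrow> exp ((y' \<sigma>)\<^sup>2) \<le> Q'"
      have sub: "S' \<subseteq> hypercube N" using S' Suc.prems by auto
      have fin: "finite S'" using sub finite_hypercube finite_subset by blast
      \<comment> \<open>The threshold of \<open>S\<close> is below that of \<open>S'\<close> with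
        one step fewer, so the failure event only grows.\<close>
      have le: "c ^ Suc n * card S \<le> c ^ n * card S'"
        using mult_left_mono[OF S'(2), of "c ^ n"] c by (simp add: mult_ac)
      have M'': "M \<le> c ^ n * card S'" using M' le by (simp add: mult_ac)
      have r': "r / sqrt (1 - p) > 0" using Suc.prems(4) p by simp
      interpret G: prob_space "std_gaussian N" by (rule prob_space_std_gaussian)
      have "measure (std_gaussian N) (sparse_event N S' y' (r / sqrt (1 - p)) (c ^ Suc n * card S / 2))
         \<le> measure (std_gaussian N) (sparse_event N S' y' (r / sqrt (1 - p)) (c ^ n * card S' / 2))"
        using le fin by (intro G.finite_measure_mono sparse_event_mono sparse_event_sets) auto
      also have "\<dots> \<le> B * \<rho> ^ n * Q' / ((r / sqrt (1 - p))\<^sup>2) ^ k"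
        unfolding c_def \<rho>_def B_def
        by (rule Suc.IH[OF sub M''[unfolded c_def] y' r'])
      also have "\<dots> = ?B * Q'" using p by (simp add: power_divide field_simps)
      finally show "measure (std_gaussian N) (sparse_event N S' y' (r / sqrt (1 - p)) (c ^ Suc n * card S / 2)) \<le> ?B * Q'" .
    qed
    also have "\<dots> = B * \<rho> ^ n / (r\<^sup>2) ^ k * (((1 - p) ^ k * A) / (1 - c)\<^sup>2)" by (simp add: field_simps)
    also have "\<dots> \<le> B * \<rho> ^ n / (r\<^sup>2) ^ k * (\<rho> * Q)"
    proof (intro mult_left_mono)
      have "((1 - p) ^ k * A) / (1 - c)\<^sup>2 \<le> (1 - \<gamma>) * Q / (1 - c)\<^sup>2" using AQ by (intro divide_right_mono) auto
      also have "\<dots> \<le> \<rho> * Q" using mult_right_mono[OF c\<rho>, of Q] Q1 by simp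
      finally show "((1 - p) ^ k * A) / (1 - c)\<^sup>2 \<le> \<rho> * Q" .
    qed (use \<rho> in \<open>simp add: B_def\<close>)
    finally show ?thesis by (simp add: mult_ac)
  qed
  have ylnQ: "(y \<sigma>)\<^sup>2 \<le> ln Q" if "\<sigma> \<in> S" for \<sigma>
    using Suc.prems(3)[OF that] Q1 by (simp add: ln_ge_iff)
  have "measure (std_gaussian N) (sparse_event N S y r (c ^ Suc n * card S / 2)) \<le> B * \<rho> ^ Suc n * Q / (r\<^sup>2) ^ k"
  \<comment> \<open>Large potential: a step of variance l^2 / ln Q, where the drift does the work
    and (1 - p)^k is merely bounded by 1.\<close>
  proof (cases "1 / l\<^sup>2 \<le> ln Q")
    case True
    define z where "z = sqrt (ln Q)"
    define p where "p = (l / z)\<^sup>2"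
    have z2: "z\<^sup>2 = ln Q" using Q1 by (simp add: z_def)
    have zl: "1 / l \<le> z" unfolding z_def using True by (intro real_le_rsqrt) (simp add: power_divide)
    have zpos: "0 < z" using zl l0 by (smt (verit) divide_pos_pos)
    have yz: "\<bar>y \<sigma>\<bar> \<le> z" if "\<sigma> \<in> S" for \<sigma>
      unfolding z_def using ylnQ[OF that] by (intro real_le_rsqrt) simp
    have "1 \<le> 1 / l" using l0 by (simp add: field_simps)
    with zl have "1 \<le> z" by (rule order_trans[rotated])
    then have "l / z \<le> l / 1" using l0 by (intro divide_left_mono) auto
    then have "l / z \<le> 1/3" using l0 by linarith
    then have "(l / z)\<^sup>2 \<le> (1/3)\<^sup>2" using l0 zpos by (intro power_mono) auto
    then have p: "0 < p" "p \<le> 1/9" using l0 zpos by (auto simp: p_def power2_eq_square)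
    show ?thesis
    proof (rule step[OF p])
      show "(\<Sum>\<sigma>\<in>S. \<Sum>\<tau>\<in>S. \<integral>g. min (exp ((y \<sigma> + sqrt p * gauss_field N g \<sigma>)\<^sup>2 / (1 - p)))
        (exp ((y \<tau> + sqrt p * gauss_field N g \<tau>)\<^sup>2 / (1 - p))) \<partial>std_gaussian N)
        \<le> (exp (z\<^sup>2) * (1 - \<gamma>)) * (real (card S))\<^sup>2"
        unfolding \<gamma> using bad[OF Suc.prems(1) cS]
        by (intro sum_min_exp_square_shift_large Suc.prems(1) N \<eta> l zl p_def yz) auto
      have "(1 - p) ^ k \<le> 1" using p by (intro power_le_one) auto
      then show "(1 - p) ^ k * (exp (z\<^sup>2) * (1 - \<gamma>)) \<le> (1 - \<gamma>) * Q"
        using z2 Q1 g mult_right_mono[of "(1 - p) ^ k" 1 "Q * (1 - \<gamma>)"] by (simp add: mult_ac)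
    qed
  next
    \<comment> \<open>Bounded potential: a fixed tenth of the variance is revealed, and the choice
      of \<open>k\<close> makes (9/10)^k outweigh the crude growth.\<close>
    case False
    show ?thesis
    proof (rule step[of "1/10"])
      show "(\<Sum>\<sigma>\<in>S. \<Sum>\<tau>\<in>S. \<integral>g. min (exp ((y \<sigma> + sqrt (1/10) * gauss_field N g \<sigma>)\<^sup>2 / (1 - 1/10)))
        (exp ((y \<tau> + sqrt (1/10) * gauss_field N g \<tau>)\<^sup>2 / (1 - 1/10))) \<partial>std_gaussian N)
        \<le> (sqrt 2 * exp (9/4 * (1 / l\<^sup>2))) * (real (card S))\<^sup>2"
        using ylnQ False by (intro sum_min_exp_square_shift_small Suc.prems(1) N) force+
      show "(1 - 1/10) ^ k * (sqrt 2 * exp (9/4 * (1 / l\<^sup>2))) \<le> (1 - \<gamma>) * Q"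
      proof -
        have "1 - \<gamma> \<le> (1 - \<gamma>) * Q" using mult_left_mono[OF Q1, of "1 - \<gamma>"] g by simp
        with k show ?thesis by (simp add: mult_ac)
      qed
    qed auto
  qed
  then show ?case unfolding c_def \<rho>_def B_def .
qed

section \<open>Strips\<close>

text \<open>Points of large overlap are counted in the whole cube, whatever \<open>S\<close> is; 8 =
  4 * 2 makes them at most a quarter of \<open>S\<close>.\<close>

lemma bad_pairs_rare:
  fixes \<eta> \<delta> :: real
  assumes ball: "\<And>\<sigma>. \<sigma> \<in> hypercube N \<Longrightarrow>
      real (card {\<tau> \<in> hypercube N. \<bar>scalar_prod N \<sigma> \<tau>\<bar> > (1 - \<eta>) * real N}) \<le> 2 * exp (real N * \<delta>)"
    and S: "S \<subseteq> hypercube N" "8 * exp (real N * \<delta>) \<le> real (card S)" and \<sigma>: "\<sigma> \<in> S"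
  shows "4 * real (card {\<tau> \<in> S. \<bar>scalar_prod N \<sigma> \<tau>\<bar> > (1 - \<eta>) * real N}) \<le> real (card S)"
proof -
  have "card {\<tau> \<in> S. \<bar>scalar_prod N \<sigma> \<tau>\<bar> > (1 - \<eta>) * real N}
    \<le> card {\<tau> \<in> hypercube N. \<bar>scalar_prod N \<sigma> \<tau>\<bar> > (1 - \<eta>) * real N}"
    using S by (intro card_mono finite_subset[OF _ finite_hypercube]) auto
  moreover have "\<sigma> \<in> hypercube N" using S \<sigma> by auto
  note ball[OF this]
  ultimately show ?thesis using S(2) by linarith
qed

text \<open>Fixes the constants in the order \<eta>, \<open>l\<close>, \<gamma>, \<open>k\<close>,
  \<open>D\<close>, before the dimension and the set appear, so that they depend on
  \<open>a\<close>, \<open>b\<close> and \<delta> only.\<close>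

lemma strip_proportion_bound:
  fixes a b \<delta> :: real
  assumes ab: "a < b" and \<delta>: "\<delta> > 0"
  obtains c \<rho> D :: real where "0 < c" "c < 1" "0 < \<rho>" "\<rho> < 1" "1 \<le> D"
    "\<And>N S n. N \<ge> 1 \<Longrightarrow> S \<subseteq> hypercube N \<Longrightarrow> 8 * exp (real N * \<delta>) \<le> c ^ n * real (card S) \<Longrightarrow>
      measure (std_gaussian N) {g \<in> space (std_gaussian N).
        real (card {\<sigma> \<in> S. scalar_prod N g \<sigma> / sqrt (real N) \<in> {a..b}}) < c ^ n * real (card S) / 2} \<le> D * \<rho> ^ n"
proof -
  obtain \<eta> :: real where \<eta>: "0 < \<eta>" "\<eta> < 1" and ball: "\<And>N \<sigma>. \<sigma> \<in> hypercube N \<Longrightarrow>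
      real (card {\<tau> \<in> hypercube N. \<bar>scalar_prod N \<sigma> \<tau>\<bar> > (1 - \<eta>) * real N}) \<le> 2 * exp (real N * \<delta>)"
    by (rule card_overlap_le[OF \<delta>]) (rule that, assumption+)
  define l where "l = sqrt (\<eta> / pi) / 3480"
  define \<gamma> where "\<gamma> = l * sqrt (\<eta> / pi)"
  have z0: "0 < sqrt (\<eta> / pi)" "sqrt (\<eta> / pi) \<le> 1" using \<eta> pi_gt3 by auto
  have l0: "0 < l" "l \<le> 1/3480" using z0 by (auto simp: l_def)
  have g: "0 < \<gamma>" "\<gamma> \<le> 1/3480"
    using mult_mono[OF l0(2) z0(2)] z0 l0 by (auto simp: \<gamma>_def)
  define K where "K = sqrt 2 * exp (9/4 * (1 / l\<^sup>2))"
  have K: "0 < K" by (simp add: K_def)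
  obtain k where "(9/10 :: real) ^ k < (1 - \<gamma>) / K"
    using real_arch_pow_inv[of "(1 - \<gamma>) / K" "9/10"] K g by auto
  then have k: "K * (9/10) ^ k \<le> 1 - \<gamma>" using K by (simp add: field_simps)
  define r where "r = (b - a) / 2"
  define m where "m = (a + b) / 2"
  \<comment> \<open>The factor exp (m^2) is the initial potential: nothing is revealed yet, so every
    point sits at distance \<bar>m\<bar> from the middle and the remaining variance is 1.\<close>
  define D where "D = max 1 (4 * 8 ^ k * fact k * exp (m\<^sup>2) / (r\<^sup>2) ^ k)"
  have r: "r > 0" using ab by (simp add: r_def)
  show ?thesis
  proof
    show "0 < \<gamma> / 4" "\<gamma> / 4 < 1" "0 < 1 - \<gamma> / 2" "1 - \<gamma> / 2 < 1" using g by auto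
    show "1 \<le> D" by (simp add: D_def)
    fix N S n
    assume N: "N \<ge> 1" and S: "S \<subseteq> hypercube N" "8 * exp (real N * \<delta>) \<le> (\<gamma> / 4) ^ n * real (card S)"
    have eq: "{g \<in> space (std_gaussian N). real (card {\<sigma> \<in> S. scalar_prod N g \<sigma> / sqrt (real N) \<in> {a..b}})
          < (\<gamma> / 4) ^ n * real (card S) / 2}
       = sparse_event N S (\<lambda>_. - m) r ((\<gamma> / 4) ^ n * real (card S) / 2)"
    proof -
      have "x \<in> {a..b} \<longleftrightarrow> \<bar>- m + x\<bar> \<le> r" for x by (auto simp: m_def r_def abs_le_iff field_simps)
      then show ?thesis by (simp only: sparse_event_def gauss_field_def)
    qed
    have "measure (std_gaussian N) (sparse_event N S (\<lambda>_. - m) r ((\<gamma> / 4) ^ n * real (card S) / 2))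
       \<le> 4 * 8 ^ k * fact k * (1 - \<gamma> / 2) ^ n * exp (m\<^sup>2) / (r\<^sup>2) ^ k"
      by (rule sparse_event_bound[OF \<eta> l_def \<gamma>_def k[unfolded K_def] N _ bad_pairs_rare[OF ball] S _ r]) auto
    also have "\<dots> = (4 * 8 ^ k * fact k * exp (m\<^sup>2) / (r\<^sup>2) ^ k) * (1 - \<gamma> / 2) ^ n" by simp
    also have "\<dots> \<le> D * (1 - \<gamma> / 2) ^ n"
      using g by (intro mult_right_mono) (auto simp: D_def)
    finally show "measure (std_gaussian N) {g \<in> space (std_gaussian N).
        real (card {\<sigma> \<in> S. scalar_prod N g \<sigma> / sqrt (real N) \<in> {a..b}}) < (\<gamma> / 4) ^ n * real (card S) / 2}
        \<le> D * (1 - \<gamma> / 2) ^ n" unfolding eq .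
  qed
qed

section \<open>Number of steps and final constant\<close>

theorem theorem1p4:
  fixes a b :: real
  assumes "a < b"
  shows "\<exists>\<delta>\<^sub>0>0. \<forall>\<delta>::real. 0 < \<delta> \<and> \<delta> < \<delta>\<^sub>0 \<longrightarrow>
    (\<exists>C>0. \<forall>(N::nat) S (w::real).
       N \<ge> 1 \<longrightarrow> S \<subseteq> hypercube N \<longrightarrow> real (card S) \<ge> exp (real N * \<delta>) \<longrightarrow>
       C \<le> w \<longrightarrow> w \<le> sqrt (real N) / C \<longrightarrow>
       \<P>(g in std_gaussian N.
           real (card {\<sigma> \<in> S. scalar_prod N g \<sigma> / sqrt (real N) \<in> {a..b}}) / real (card S)
             < 1 / exp w)
         \<le> exp (- (w / C)))"
proof (rule exI[of _ "1 :: real"], intro conjI allI impI)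
  fix \<delta> :: real
  assume "0 < \<delta> \<and> \<delta> < 1"
  \<comment> \<open>The exponent budget: of N \<delta>, at most N \<delta> / 2 is lost to the
    selection and N \<delta> / 4 to the factor 8, which leaves N \<delta> / 4 for the overlap
    bound.\<close>
  then have \<delta>: "\<delta> > 0" "\<delta> / 4 > 0" by auto
  obtain c \<rho> D :: real where c: "0 < c" "c < 1" and \<rho>: "0 < \<rho>" "\<rho> < 1" and D: "1 \<le> D" and
    bound: "\<And>N S n. N \<ge> 1 \<Longrightarrow> S \<subseteq> hypercube N \<Longrightarrow> 8 * exp (real N * (\<delta> / 4)) \<le> c ^ n * real (card S) \<Longrightarrow>
      measure (std_gaussian N) {g \<in> space (std_gaussian N).
        real (card {\<sigma> \<in> S. scalar_prod N g \<sigma> / sqrt (real N) \<in> {a..b}}) < c ^ n * real (card S) / 2} \<le> D * \<rho> ^ n"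
    by (rule strip_proportion_bound[OF assms \<delta>(2)]) (rule that, assumption+)
  define K where "K = - ln c"
  define R where "R = - ln \<rho>"
  have K: "K > 0" "exp (- K) = c" and R: "R > 0" "exp (- R) = \<rho>" using c \<rho> by (auto simp: K_def R_def)
  define h where "h = R / (2 * K)"
  have h: "h > 0" using K R by (simp add: h_def)
  \<comment> \<open>In order, the entries give exp (w / 2) >= 2, w <= N \<delta>, ln 8 <= N \<delta>
    / 4, the final rate w / C <= w h / 2, and room for \<open>D\<close> and the rounding of
    \<open>n\<close>.\<close>
  define C where "C = max 2 (max (1 / \<delta>) (max (4 * ln 8 / \<delta>) (max (2 / h) (2 * (ln D + R) / h))))"
  have C: "C \<ge> 2" "C \<ge> 1 / \<delta>" "C \<ge> 4 * ln 8 / \<delta>" "C \<ge> 2 / h" "C \<ge> 2 * (ln D + R) / h"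
    by (auto simp: C_def)
  show "\<exists>C>0. \<forall>(N::nat) S (w::real).
       N \<ge> 1 \<longrightarrow> S \<subseteq> hypercube N \<longrightarrow> real (card S) \<ge> exp (real N * \<delta>) \<longrightarrow>
       C \<le> w \<longrightarrow> w \<le> sqrt (real N) / C \<longrightarrow>
       \<P>(g in std_gaussian N.
           real (card {\<sigma> \<in> S. scalar_prod N g \<sigma> / sqrt (real N) \<in> {a..b}}) / real (card S)
             < 1 / exp w)
         \<le> exp (- (w / C))"
  proof (rule exI[of _ C], intro conjI allI impI)
    show "C > 0" using C by simp
    fix N :: nat and S and w :: real
    assume N: "N \<ge> 1" and S: "S \<subseteq> hypercube N" "real (card S) \<ge> exp (real N * \<delta>)"
      and w: "C \<le> w" "w \<le> sqrt (real N) / C"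
    interpret prob_space "std_gaussian N" by (rule prob_space_std_gaussian)
    have fin: "finite S" using S finite_hypercube finite_subset by blast
    have w2: "w \<ge> 2" using w C by linarith
    have cS: "real (card S) > 0" using S(2) by (smt (verit) exp_gt_zero)
    \<comment> \<open>As many steps as keep c^n >= exp (- w / 2); the other factor exp (- w / 2)
      covers the 1/2 in the threshold.\<close>
    define n where "n = nat \<lfloor>w / (2 * K)\<rfloor>"
    have wK: "w / (2 * K) \<ge> 0" using w2 K by simp
    have n: "real n \<le> w / (2 * K)" "w / (2 * K) - 1 \<le> real n"
      using wK by (auto simp: n_def)
    have nK: "real n * K \<le> w / 2"
      using mult_right_mono[OF n(1), of K] K by simp
    have cn: "c ^ n = exp (- (real n * K))"
      using exp_of_nat_mult[of n "- K"] K by simp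
    have sN: "sqrt (real N) \<le> real N"
    proof -
      have "sqrt (real N) * 1 \<le> sqrt (real N) * sqrt (real N)"
        using N by (intro mult_left_mono) auto
      then show ?thesis by simp
    qed
    have wC: "w * C \<le> sqrt (real N)" using w(2) C by (simp add: pos_le_divide_eq)
    have wN: "w \<le> real N * \<delta>"
    proof -
      have "w * (1 / \<delta>) \<le> w * C" using C w2 by (intro mult_left_mono) auto
      then have "w * (1 / \<delta>) \<le> real N" using wC sN by linarith
      then show ?thesis using \<delta> by (simp add: field_simps)
    qed
    have N8: "ln 8 \<le> real N * (\<delta> / 4)"
    proof -
      have "1 * (4 * ln 8 / \<delta>) \<le> w * C" using C w2 \<delta> by (intro mult_mono) auto
      then have "4 * ln 8 / \<delta> \<le> real N" using wC sN by linarith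
      then show ?thesis using \<delta> by (simp add: field_simps)
    qed
    have "8 * exp (real N * (\<delta> / 4)) = exp (ln 8 + real N * (\<delta> / 4))" by (simp add: exp_add)
    also have "\<dots> \<le> exp (- (real n * K) + real N * \<delta>)"
      unfolding exp_le_cancel_iff using N8 nK wN by linarith
    also have "\<dots> \<le> c ^ n * card S"
      unfolding exp_add cn using S(2) by (intro mult_left_mono) auto
    finally have big: "8 * exp (real N * (\<delta> / 4)) \<le> c ^ n * card S" .
    have half: "1 / exp w \<le> c ^ n / 2"
    proof -
      have "exp (real n * K) * 2 \<le> exp (w / 2) * exp (w / 2)"
      proof (intro mult_mono)
        show "2 \<le> exp (w / 2)" using exp_ge_add_one_self[of "w / 2"] w2 by linarith
      qed (use nK in auto)
      then show ?thesis by (simp add: cn exp_minus exp_add[symmetric] field_simps)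
    qed
    let ?card = "\<lambda>g. real (card {\<sigma> \<in> S. scalar_prod N g \<sigma> / sqrt (real N) \<in> {a..b}})"
    have meas: "{g \<in> space (std_gaussian N). ?card g < c ^ n * real (card S) / 2} \<in> sets (std_gaussian N)"
    proof -
      have "?card g = (\<Sum>\<sigma>\<in>S. if scalar_prod N g \<sigma> / sqrt (real N) \<in> {a..b} then 1 else 0)" for g
        using fin by (simp add: sum.If_cases Int_def)
      then show ?thesis by simp measurable
    qed
    have "\<P>(g in std_gaussian N. ?card g / real (card S) < 1 / exp w)
      \<le> measure (std_gaussian N) {g \<in> space (std_gaussian N). ?card g < c ^ n * real (card S) / 2}"
    proof (intro finite_measure_mono meas subsetI)
      fix g assume g: "g \<in> {g \<in> space (std_gaussian N). ?card g / real (card S) < 1 / exp w}"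
      then have "?card g / real (card S) < 1 / exp w" by blast
      then have "?card g / real (card S) < c ^ n / 2" using half by (rule less_le_trans)
      then show "g \<in> {g \<in> space (std_gaussian N). ?card g < c ^ n * real (card S) / 2}"
        using g cS by (simp add: pos_divide_less_eq mult.commute)
    qed
    also have "\<dots> \<le> D * \<rho> ^ n" by (rule bound[OF N S(1) big])
    also have "\<dots> = exp (ln D - real n * R)"
    proof -
      have "\<rho> ^ n = exp (- (real n * R))" using exp_of_nat_mult[of n "- R"] R by simp
      then show ?thesis using D by (simp add: diff_conv_add_uminus exp_add del: add_uminus_conv_diff)
    qed
    also have "\<dots> \<le> exp (- (w / C))"
    proof -
      \<comment> \<open>Rounding \<open>n\<close> down loses at most one step, that is, one
        \<open>R\<close>.\<close>
      have "w * h - R \<le> real n * R"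
        using mult_right_mono[OF n(2), of R] R by (simp add: h_def algebra_simps)
      moreover have "ln D + R \<le> w * h / 2"
        using order_trans[OF C(5) w(1)] h by (simp add: field_simps)
      moreover have "w / C \<le> w * h / 2"
      proof -
        have "1 / C \<le> h / 2" using C h by (simp add: field_simps)
        then show ?thesis using mult_left_mono[of "1 / C" "h / 2" w] w2 by simp
      qed
      ultimately show ?thesis unfolding exp_le_cancel_iff by linarith
    qed
    finally show "\<P>(g in std_gaussian N. ?card g / real (card S) < 1 / exp w) \<le> exp (- (w / C))" .
  qed
qed simp

end
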